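(* Let $0<\beta_0<\beta_1<\infty$ and put $\rho=\frac{2-\sqrt3}{2+\sqrt3}$. With the notation given in the context, the following hold as $n\to\infty$. (I) Uniformly over $\theta\in[\beta_0,\beta_1]$ and $3\le i\le n-2$, $$\begin{aligned}(R_{\theta,n}^{-1})_{i,i}=\Bigg\{&\frac{C_{1,1}\tau_{-1}u^4}{\alpha_1-\alpha_2}\left\{\frac{\alpha_1-u^2}{[-(b+\tau_{-1}u)\alpha_1]^3}-\frac{\alpha_2-u^2}{[-(b+\tau_{-1}u)\alpha_1]^3}\left(\frac{\alpha_2}{\alpha_1}\right)^{n-i-2}\right\}\\ &-\frac{C_{1,2}\tau_{-1}u^4(\tilde a\alpha_2+u^2\tilde b)}{(\alpha_1-\alpha_2)(\tilde a\alpha_1+u^2\tilde b)}\left\{\frac{\alpha_1-u^2}{[-(b+\tau_{-1}u)\alpha_2]^3}\left(\frac{\alpha_2}{\alpha_1}\right)^{i}-\frac{\alpha_2-u^2}{[-(b+\tau_{-1}u)\alpha_2]^3}\left(\frac{\alpha_2}{\alpha_1}\right)^{n-2}\right\}\\ &+\frac{C_{2,1}\tau_{-1}u^6}{\alpha_1-\alpha_2}\left\{\frac{1}{[-(b+\tau_{-1}u)\alpha_1]^3}-\frac{1}{[-(b+\tau_{-1}u)\alpha_1]^3}\left(\frac{\alpha_2}{\alpha_1}\right)^{n-i-2}\right\}\\ &-\frac{C_{2,2}\tau_{-1}u^6(\tilde a\alpha_2+u^2\tilde b)}{(\alpha_1-\alpha_2)(\tilde a\alpha_1+u^2\tilde b)}\left\{\frac{1}{[-(b+\tau_{-1}u)\alpha_2]^3}\left(\frac{\alpha_2}{\alpha_1}\right)^{i}-\frac{1}{[-(b+\tau_{-1}u)\alpha_2]^3}\left(\frac{\alpha_2}{\alpha_1}\right)^{n-2}\right\}\Bigg\}[1+O(\rho^n)].\end{aligned}$$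 (II) Uniformly over $\theta\in[\beta_0,\beta_1]$ and $5\le i+2\le j\le n-1$, $$\begin{aligned}(R_{\theta,n}^{-1})_{i,j}=\frac{1}{\tau_{-1}^4(\alpha_1-\alpha_2)}\left(\frac{u}{\alpha_1}\right)^{j-i+2}\Bigg\{&C_{6,1}\left[(a\alpha_1+u^2b)-(a\alpha_2+u^2b)\left(\frac{\alpha_2}{\alpha_1}\right)^{n-j-1}\right]\\ &-\frac{C_{6,2}(\tilde a\alpha_2+u^2\tilde b)}{\tilde a\alpha_1+u^2\tilde b}\left[(a\alpha_1+u^2b)\left(\frac{\alpha_2}{\alpha_1}\right)^{i-3}-(a\alpha_2+u^2b)\left(\frac{\alpha_2}{\alpha_1}\right)^{n-j+i-4}\right]\Bigg\}[1+O(\rho^n)].\end{aligned}$$ (III) Uniformly over $\theta\in[\beta_0,\beta_1]$ and $3\le i\le n-2$, $$\begin{aligned}(R_{\theta,n}^{-1})_{i,i+1}=-\Bigg\{&\frac{C_{4,1}\tau_{-1}u^4}{\alpha_1-\alpha_2}\left\{\frac{\alpha_1-u^2}{[-(b+\tau_{-1}u)\alpha_1]^3}-\frac{\alpha_2-u^2}{[-(b+\tau_{-1}u)\alpha_1]^3}\left(\frac{\alpha_2}{\alpha_1}\right)^{n-i-2}\right\}\\ &-\frac{C_{4,2}\tau_{-1}u^4(\tilde a\alpha_2+u^2\tilde b)}{(\alpha_1-\alpha_2)(\tilde a\alpha_1+u^2\tilde b)}\left\{\frac{\alpha_1-u^2}{[-(b+\tau_{-1}u)\alpha_2]^3}\left(\frac{\alpha_2}{\alpha_1}\right)^{i}-\frac{\alpha_2-u^2}{[-(b+\tau_{-1}u)\alpha_2]^3}\left(\frac{\alpha_2}{\alpha_1}\right)^{n-2}\right\}\\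 &+\frac{C_{5,1}\tau_{-1}u^6}{\alpha_1-\alpha_2}\left\{\frac{1}{[-(b+\tau_{-1}u)\alpha_1]^3}-\frac{1}{[-(b+\tau_{-1}u)\alpha_1]^3}\left(\frac{\alpha_2}{\alpha_1}\right)^{n-i-2}\right\}\\ &-\frac{C_{5,2}\tau_{-1}u^6(\tilde a\alpha_2+u^2\tilde b)}{(\alpha_1-\alpha_2)(\tilde a\alpha_1+u^2\tilde b)}\left\{\frac{1}{[-(b+\tau_{-1}u)\alpha_2]^3}\left(\frac{\alpha_2}{\alpha_1}\right)^{i}-\frac{1}{[-(b+\tau_{-1}u)\alpha_2]^3}\left(\frac{\alpha_2}{\alpha_1}\right)^{n-2}\right\}\Bigg\}[1+O(\rho^n)].\end{aligned}$$ (IV) Uniformly over $\theta\in[\beta_0,\beta_1]$ and $3\le i\le n-2$, $$(R_{\theta,n}^{-1})_{i,n}=\left\{\frac{C_{6,1}}{[-(b+\tau_{-1}u)\alpha_1]^3}\left(\frac{u}{\alpha_1}\right)^{n-i-2}-\frac{C_{6,2}(\tilde a\alpha_2+u^2\tilde b)}{(\tilde a\alpha_1+u^2\tilde b)[-(b+\tau_{-1}u)\alpha_2]^3}\left(\frac{u}{\alpha_1}\right)^{n-i-2}\left(\frac{\alpha_2}{\alpha_1}\right)^{i}\right\}[1+O(\rho^n)].$$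
   Context: Notation: $w=\theta/n$, $u=e^{-w}$. $R_{\theta,n}$ is the $n\times n$ matrix with $(k,l)$th element $(1+|k-l|w)u^{|k-l|}$, and $(R_{\theta,n}^{-1})_{k,l}$ is the $(k,l)$th element of its inverse. $\tau_{-1}=(w-1)u+(1+w)u^3$. $\hat\tau_{-2}=2\tau_{-1}u$, $\hat\tau_{-1}=(1+w)u-3(1+w)u^3+2(1+2w)u^5$, $\hat\tau_k=(1+kw)u^k-3(1+(k+2)w)u^{k+4}+2(1+(k+3)w)u^{k+6}$ for $k\ge0$. $\tilde\tau_{-2}=\tau_{-1}u/2$, $\tilde\tau_{-1}=\frac12[(2w-1)u+(1+2w)u^5]$, $\tilde\tau_k=\frac12[2(1+kw)u^k-3(1+(k+1)w)u^{k+2}+(1+(k+3)w)u^{k+6}]$ for $k\ge0$. $a=1-2u^2+u^4-2u^2w+2u^4w$, $b=2u^2-u^4+w-u^4w-1$, $\tilde a=1-u^2-2u^2w-u^2w^2$, $\tilde b=u^2+w+u^2w-1$, $$\alpha_1=\frac{-(a-2\tau_{-1}u)-\sqrt{(a-2\tau_{-1}u)^2-4\tau_{-1}u(b+\tau_{-1}u)}}{2(b+\tau_{-1}u)},\quad \alpha_2=\frac{-(a-2\tau_{-1}u)+\sqrt{(a-2\tau_{-1}u)^2-4\tau_{-1}u(b+\tau_{-1}u)}}{2(b+\tau_{-1}u)}.$$ For $l=1,2$ write $X_l=(b+\tau_{-1}u)\alpha_l-\tau_{-1}u$. The constants are $$C_{1,l}=\frac{\hat\tau_{-2}\tilde\tau_0[w(2-6u^2+4u^4)+(1-u^2)^2]}{\tau_{-1}u^2X_l}+\frac{w\hat\tau_{-2}\tilde\tau_0(1-u^2)^2}{uX_l^2}+\frac{\hat\tau_0\tilde\tau_0-\hat\tau_1\tilde\tau_{-1}}{\tau_{-1}u^4}-\frac{\hat\tau_{-2}\tilde\tau_{-1}[w(3-8u^2+5u^4)+(1-u^2)^2]}{\tau_{-1}uX_l}-\frac{w\hat\tau_{-2}\tilde\tau_{-1}(1-u^2)^2}{X_l^2},$$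 $$C_{2,l}=\frac{w\hat\tau_{-2}(2-3u^2+u^6)[w(2-6u^2+4u^4)+(1-u^2)^2]}{2\tau_{-1}u^2X_l}+\frac{w^2\hat\tau_{-2}(2-3u^2+u^6)(1-u^2)^2}{2uX_l^2}+\frac{w\hat\tau_0(2-3u^2+u^6)}{2\tau_{-1}u^4}-\frac{w(1-u^2)^2\hat\tau_{-2}\tilde\tau_{-1}}{\tau_{-1}uX_l}-\frac{w(1-3u^4+2u^6)\tilde\tau_{-1}}{\tau_{-1}u^3},$$ $$C_{4,l}=\frac{\hat\tau_{-1}\tilde\tau_0}{\tau_{-1}u^4}+\frac{\hat\tau_{-2}\tilde\tau_0[w(1-4u^2+3u^4)+(1-u^2)^2]}{\tau_{-1}u^3X_l}+\frac{w\tau_{-1}\hat\tau_{-2}\tilde\tau_0(1-u^2)^2}{\tau_{-1}u^2X_l^2}-\frac{\hat\tau_1\tilde\tau_{-2}}{\tau_{-1}u^4}-\frac{\hat\tau_{-2}\tilde\tau_{-2}[w(3-8u^2+5u^4)+(1-u^2)^2]}{\tau_{-1}uX_l}-\frac{w\hat\tau_{-2}\tilde\tau_{-2}(1-u^2)^2}{X_l^2},$$ $$C_{5,l}=\frac{w\hat\tau_{-1}(2-3u^2+u^6)}{2\tau_{-1}u^4}+\frac{w\hat\tau_{-2}(2-3u^2+u^6)[w(1-4u^2+3u^4)+(1-u^2)^2]}{2\tau_{-1}u^3X_l}+\frac{w^2\hat\tau_{-2}(2-3u^2+u^6)(1-u^2)^2}{2u^2X_l^2}-\frac{w\hat\tau_{-2}\tilde\tau_{-2}(1-u^2)^2}{\tau_{-1}uX_l}-\frac{w(1-3u^4+2u^6)\tilde\tau_{-2}}{\tau_{-1}u^3},$$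 $$C_{6,l}=\hat\tau_{-1}\tilde\tau_{-1}-\hat\tau_0\tilde\tau_{-2}+\frac{\hat\tau_{-2}u\tilde\tau_{-1}[w(1-4u^2+3u^4)+(1-u^2)^2]}{X_l}-\frac{\hat\tau_{-2}\tilde\tau_{-2}u^2[w(2-6u^2+4u^4)+(1-u^2)^2]}{X_l}+\frac{w\tau_{-1}u^2\hat\tau_{-2}(\tilde\tau_{-1}-u\tilde\tau_{-2})(1-u^2)^2}{X_l^2}.$$ *)

theory Defs
  imports Complex_Main "Jordan_Normal_Form.Gauss_Jordan_Elimination"
begin

text \<open>Matrices of \<^theory>\<open>Jordan_Normal_Form.Matrix\<close> are indexed from 0, the entries
  in the mathematical text from 1; \<open>Rinv\<close> below takes 1-based indices.\<close>

definition Rmat :: "real \<Rightarrow> nat \<Rightarrow> real mat" where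
  "Rmat \<theta> n = mat n n (\<lambda>(k, l).
     (1 + real (nat \<bar>int k - int l\<bar>) * (\<theta> / real n)) * exp (- (\<theta> / real n)) ^ nat \<bar>int k - int l\<bar>)"

definition Rinv :: "real \<Rightarrow> nat \<Rightarrow> nat \<Rightarrow> nat \<Rightarrow> real" where
  "Rinv \<theta> n k l = the (mat_inverse (Rmat \<theta> n)) $$ (k - 1, l - 1)"

text \<open>All remaining quantities depend on \<open>\<theta>\<close> and \<open>n\<close> only through \<open>w = \<theta> / n\<close>, which is
  their first argument; throughout, \<open>u = exp (- w)\<close>. The negative indices of the families
  \<open>\<tau>\<close>, \<open>\<tau>\<close>-hat and \<open>\<tau>\<close>-tilde are written \<open>m1\<close> for \<open>-1\<close> and \<open>m2\<close> for \<open>-2\<close>.\<close>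

definition tau_m1 :: "real \<Rightarrow> real" where
  "tau_m1 w = (let u = exp (- w) in (w - 1) * u + (1 + w) * u ^ 3)"

definition tauhat_m2 :: "real \<Rightarrow> real" where
  "tauhat_m2 w = (let u = exp (- w) in 2 * tau_m1 w * u)"

definition tauhat_m1 :: "real \<Rightarrow> real" where
  "tauhat_m1 w = (let u = exp (- w) in
     (1 + w) * u - 3 * (1 + w) * u ^ 3 + 2 * (1 + 2 * w) * u ^ 5)"

definition tauhat :: "real \<Rightarrow> nat \<Rightarrow> real" where
  "tauhat w k = (let u = exp (- w) in
     (1 + real k * w) * u ^ k - 3 * (1 + real (k + 2) * w) * u ^ (k + 4)
     + 2 * (1 + real (k + 3) * w) * u ^ (k + 6))"

definition tautil_m2 :: "real \<Rightarrow> real" where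
  "tautil_m2 w = (let u = exp (- w) in tau_m1 w * u / 2)"

definition tautil_m1 :: "real \<Rightarrow> real" where
  "tautil_m1 w = (let u = exp (- w) in 1 / 2 * ((2 * w - 1) * u + (1 + 2 * w) * u ^ 5))"

definition tautil :: "real \<Rightarrow> nat \<Rightarrow> real" where
  "tautil w k = (let u = exp (- w) in
     1 / 2 * (2 * (1 + real k * w) * u ^ k - 3 * (1 + real (k + 1) * w) * u ^ (k + 2)
              + (1 + real (k + 3) * w) * u ^ (k + 6)))"

definition coef_a :: "real \<Rightarrow> real" where
  "coef_a w = (let u = exp (- w) in 1 - 2 * u ^ 2 + u ^ 4 - 2 * u ^ 2 * w + 2 * u ^ 4 * w)"

definition coef_b :: "real \<Rightarrow> real" where
  "coef_b w = (let u = exp (- w) in 2 * u ^ 2 - u ^ 4 + w - u ^ 4 * w - 1)"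

definition coef_at :: "real \<Rightarrow> real" where
  "coef_at w = (let u = exp (- w) in 1 - u ^ 2 - 2 * u ^ 2 * w - u ^ 2 * w ^ 2)"

definition coef_bt :: "real \<Rightarrow> real" where
  "coef_bt w = (let u = exp (- w) in u ^ 2 + w + u ^ 2 * w - 1)"

definition alpha1 :: "real \<Rightarrow> real" where
  "alpha1 w = (let u = exp (- w); a = coef_a w; b = coef_b w; t = tau_m1 w in
     (- (a - 2 * t * u) - sqrt ((a - 2 * t * u) ^ 2 - 4 * t * u * (b + t * u)))
     / (2 * (b + t * u)))"

definition alpha2 :: "real \<Rightarrow> real" where
  "alpha2 w = (let u = exp (- w); a = coef_a w; b = coef_b w; t = tau_m1 w in
     (- (a - 2 * t * u) + sqrt ((a - 2 * t * u) ^ 2 - 4 * t * u * (b + t * u)))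
     / (2 * (b + t * u)))"

text \<open>The constants indexed by \<open>l = 1, 2\<close> depend on \<open>l\<close> only through \<open>\<alpha>\<^sub>l\<close>, which is passed
  as the second argument: \<open>C\<^sub>k\<^sub>,\<^sub>l\<close> is \<open>Ck w (alphal w)\<close>.\<close>

definition X_of :: "real \<Rightarrow> real \<Rightarrow> real" where
  "X_of w \<alpha> = (let u = exp (- w); b = coef_b w; t = tau_m1 w in (b + t * u) * \<alpha> - t * u)"

definition C1 :: "real \<Rightarrow> real \<Rightarrow> real" where
  "C1 w \<alpha> = (let u = exp (- w); t = tau_m1 w; X = X_of w \<alpha>; h2 = tauhat_m2 w;
      h0 = tauhat w 0; hp1 = tauhat w 1; s1 = tautil_m1 w; s0 = tautil w 0 in
     h2 * s0 * (w * (2 - 6 * u ^ 2 + 4 * u ^ 4) + (1 - u ^ 2) ^ 2) / (t * u ^ 2 * X)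
     + w * h2 * s0 * (1 - u ^ 2) ^ 2 / (u * X ^ 2)
     + (h0 * s0 - hp1 * s1) / (t * u ^ 4)
     - h2 * s1 * (w * (3 - 8 * u ^ 2 + 5 * u ^ 4) + (1 - u ^ 2) ^ 2) / (t * u * X)
     - w * h2 * s1 * (1 - u ^ 2) ^ 2 / X ^ 2)"

definition C2 :: "real \<Rightarrow> real \<Rightarrow> real" where
  "C2 w \<alpha> = (let u = exp (- w); t = tau_m1 w; X = X_of w \<alpha>; h2 = tauhat_m2 w;
      h0 = tauhat w 0; s1 = tautil_m1 w in
     w * h2 * (2 - 3 * u ^ 2 + u ^ 6) * (w * (2 - 6 * u ^ 2 + 4 * u ^ 4) + (1 - u ^ 2) ^ 2)
       / (2 * t * u ^ 2 * X)
     + w ^ 2 * h2 * (2 - 3 * u ^ 2 + u ^ 6) * (1 - u ^ 2) ^ 2 / (2 * u * X ^ 2)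
     + w * h0 * (2 - 3 * u ^ 2 + u ^ 6) / (2 * t * u ^ 4)
     - w * (1 - u ^ 2) ^ 2 * h2 * s1 / (t * u * X)
     - w * (1 - 3 * u ^ 4 + 2 * u ^ 6) * s1 / (t * u ^ 3))"

definition C4 :: "real \<Rightarrow> real \<Rightarrow> real" where
  "C4 w \<alpha> = (let u = exp (- w); t = tau_m1 w; X = X_of w \<alpha>; h2 = tauhat_m2 w;
      h1 = tauhat_m1 w; hp1 = tauhat w 1; s2 = tautil_m2 w; s0 = tautil w 0 in
     h1 * s0 / (t * u ^ 4)
     + h2 * s0 * (w * (1 - 4 * u ^ 2 + 3 * u ^ 4) + (1 - u ^ 2) ^ 2) / (t * u ^ 3 * X)
     + w * t * h2 * s0 * (1 - u ^ 2) ^ 2 / (t * u ^ 2 * X ^ 2)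
     - hp1 * s2 / (t * u ^ 4)
     - h2 * s2 * (w * (3 - 8 * u ^ 2 + 5 * u ^ 4) + (1 - u ^ 2) ^ 2) / (t * u * X)
     - w * h2 * s2 * (1 - u ^ 2) ^ 2 / X ^ 2)"

definition C5 :: "real \<Rightarrow> real \<Rightarrow> real" where
  "C5 w \<alpha> = (let u = exp (- w); t = tau_m1 w; X = X_of w \<alpha>; h2 = tauhat_m2 w;
      h1 = tauhat_m1 w; s2 = tautil_m2 w in
     w * h1 * (2 - 3 * u ^ 2 + u ^ 6) / (2 * t * u ^ 4)
     + w * h2 * (2 - 3 * u ^ 2 + u ^ 6) * (w * (1 - 4 * u ^ 2 + 3 * u ^ 4) + (1 - u ^ 2) ^ 2)
       / (2 * t * u ^ 3 * X)
     + w ^ 2 * h2 * (2 - 3 * u ^ 2 + u ^ 6) * (1 - u ^ 2) ^ 2 / (2 * u ^ 2 * X ^ 2)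
     - w * h2 * s2 * (1 - u ^ 2) ^ 2 / (t * u * X)
     - w * (1 - 3 * u ^ 4 + 2 * u ^ 6) * s2 / (t * u ^ 3))"

definition C6 :: "real \<Rightarrow> real \<Rightarrow> real" where
  "C6 w \<alpha> = (let u = exp (- w); t = tau_m1 w; X = X_of w \<alpha>; h2 = tauhat_m2 w;
      h1 = tauhat_m1 w; h0 = tauhat w 0; s2 = tautil_m2 w; s1 = tautil_m1 w in
     h1 * s1 - h0 * s2
     + h2 * u * s1 * (w * (1 - 4 * u ^ 2 + 3 * u ^ 4) + (1 - u ^ 2) ^ 2) / X
     - h2 * s2 * u ^ 2 * (w * (2 - 6 * u ^ 2 + 4 * u ^ 4) + (1 - u ^ 2) ^ 2) / X
     + w * t * u ^ 2 * h2 * (s1 - u * s2) * (1 - u ^ 2) ^ 2 / X ^ 2)"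

text \<open>The main terms. Those for the entries \<open>(i, i)\<close> and \<open>(i, i + 1)\<close> have the same shape,
  up to sign, with \<open>(C, D) = (C1, C2)\<close> and \<open>(C, D) = (C4, C5)\<close>. In the ranges of \<open>i\<close> and \<open>j\<close>
  to which they are applied, no subtraction of natural numbers in the exponents truncates.\<close>

definition band_main :: "(real \<Rightarrow> real \<Rightarrow> real) \<Rightarrow> (real \<Rightarrow> real \<Rightarrow> real) \<Rightarrow> real \<Rightarrow> nat \<Rightarrow> nat \<Rightarrow> real" where
  "band_main C D w n i = (let u = exp (- w); t = tau_m1 w; b = coef_b w;
      ta = coef_at w; tb = coef_bt w; x1 = alpha1 w; x2 = alpha2 w in
     C w x1 * t * u ^ 4 / (x1 - x2)
       * ((x1 - u ^ 2) / (- (b + t * u) * x1) ^ 3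
          - (x2 - u ^ 2) / (- (b + t * u) * x1) ^ 3 * (x2 / x1) ^ (n - i - 2))
     - C w x2 * t * u ^ 4 * (ta * x2 + u ^ 2 * tb) / ((x1 - x2) * (ta * x1 + u ^ 2 * tb))
       * ((x1 - u ^ 2) / (- (b + t * u) * x2) ^ 3 * (x2 / x1) ^ i
          - (x2 - u ^ 2) / (- (b + t * u) * x2) ^ 3 * (x2 / x1) ^ (n - 2))
     + D w x1 * t * u ^ 6 / (x1 - x2)
       * (1 / (- (b + t * u) * x1) ^ 3
          - 1 / (- (b + t * u) * x1) ^ 3 * (x2 / x1) ^ (n - i - 2))
     - D w x2 * t * u ^ 6 * (ta * x2 + u ^ 2 * tb) / ((x1 - x2) * (ta * x1 + u ^ 2 * tb))
       * (1 / (- (b + t * u) * x2) ^ 3 * (x2 / x1) ^ i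
          - 1 / (- (b + t * u) * x2) ^ 3 * (x2 / x1) ^ (n - 2)))"

definition main_diag :: "real \<Rightarrow> nat \<Rightarrow> nat \<Rightarrow> real" where
  "main_diag w n i = band_main C1 C2 w n i"

definition main_superdiag :: "real \<Rightarrow> nat \<Rightarrow> nat \<Rightarrow> real" where
  "main_superdiag w n i = - band_main C4 C5 w n i"

definition main_offdiag :: "real \<Rightarrow> nat \<Rightarrow> nat \<Rightarrow> nat \<Rightarrow> real" where
  "main_offdiag w n i j = (let u = exp (- w); t = tau_m1 w; a = coef_a w; b = coef_b w;
      ta = coef_at w; tb = coef_bt w; x1 = alpha1 w; x2 = alpha2 w in
     1 / (t ^ 4 * (x1 - x2)) * (u / x1) ^ (j - i + 2)
     * (C6 w x1 * ((a * x1 + u ^ 2 * b) - (a * x2 + u ^ 2 * b) * (x2 / x1) ^ (n - j - 1))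
        - C6 w x2 * (ta * x2 + u ^ 2 * tb) / (ta * x1 + u ^ 2 * tb)
          * ((a * x1 + u ^ 2 * b) * (x2 / x1) ^ (i - 3)
             - (a * x2 + u ^ 2 * b) * (x2 / x1) ^ (n - j + i - 4))))"

definition main_lastcol :: "real \<Rightarrow> nat \<Rightarrow> nat \<Rightarrow> real" where
  "main_lastcol w n i = (let u = exp (- w); t = tau_m1 w; b = coef_b w;
      ta = coef_at w; tb = coef_bt w; x1 = alpha1 w; x2 = alpha2 w in
     C6 w x1 / (- (b + t * u) * x1) ^ 3 * (u / x1) ^ (n - i - 2)
     - C6 w x2 * (ta * x2 + u ^ 2 * tb) / ((ta * x1 + u ^ 2 * tb) * (- (b + t * u) * x2) ^ 3)
       * (u / x1) ^ (n - i - 2) * (x2 / x1) ^ i)"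

end

theory Submission
  imports Defs "Jordan_Normal_Form.Determinant"
begin

text \<open>
  The matrix \<open>R\<close> is the covariance matrix of a stationary process sampled at spacing \<open>w\<close>, with
  autocovariance \<open>c\<^sub>m = (1 + m w) u\<^sup>m\<close>. This sequence satisfies
  \<open>c\<^sub>m\<^sub>+\<^sub>2 - 2 u c\<^sub>m\<^sub>+\<^sub>1 + u\<^sup>2 c\<^sub>m = 0\<close>, so replacing \<open>x\<^sub>k\<close> by
  \<open>x\<^sub>k - 2 u x\<^sub>k\<^sub>-\<^sub>1 + u\<^sup>2 x\<^sub>k\<^sub>-\<^sub>2\<close> leaves only correlations between neighbours. In matrix form,
  \<open>T R T\<^sup>T = M\<close> is tridiagonal, with constant coefficients apart from the first two rows
  (\<open>whitened_cov\<close>), and therefore \<open>R\<^sup>-\<^sup>1 = T\<^sup>T M\<^sup>-\<^sup>1 T\<close>.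

  The inverse of a tridiagonal matrix is a discrete Green function
  \<open>\<phi>\<^bsub>min(p,q)\<^esub> \<psi>\<^bsub>max(p,q)\<^esub> / W\<close> (\<open>tridiag_green_inverse\<close>), where \<open>\<phi>\<close> and \<open>\<psi>\<close> solve the
  three-term recurrence with the left and the right boundary condition. Its symbol
  \<open>\<tau> x\<^sup>2 + \<gamma> x + \<tau>\<close>, where \<open>\<tau> = \<tau>\<^sub>-\<^sub>1\<close> and \<open>\<gamma> = 1 - 4 w u\<^sup>2 - u\<^sup>4\<close>, has two negative roots
  \<open>y < z\<close> with product 1, and the roots in the statement are \<open>\<alpha>\<^sub>1 = u y\<close> and \<open>\<alpha>\<^sub>2 = u z\<close>. Up to
  boundary terms, \<open>\<phi>\<close> and \<open>\<psi>\<close> are combinations of powers of \<open>y\<close> and \<open>z\<close>, on which the filter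
  acts by the factors \<open>(1 - u y)\<^sup>2\<close> and \<open>(1 - u z)\<^sup>2\<close>. This gives every entry of the inverse in
  closed form.

  The only place where \<open>n\<close> enters other than through the displayed powers is
  \<open>W = - \<tau> (y - z) y\<^sup>n (1 - x)\<close>, where \<open>x = \<Theta> r\<^sup>n\<^sup>-\<^sup>1\<close>, \<open>r = \<alpha>\<^sub>2 / \<alpha>\<^sub>1 = z\<^sup>2\<close> and \<open>\<Theta>\<close> is a
  boundary constant. Multiplying an entry by \<open>1 - x\<close> yields the corresponding main term
  exactly (\<open>Rinv_main_exact\<close>), so that the relative error is \<open>x / (1 - x)\<close> for all four kinds of
  entries. It remains to see that \<open>0 < \<Theta> \<le> 1\<close> and \<open>r \<le> \<rho>\<close>. The latter says that
  \<open>\<gamma> \<ge> 4 \<tau>\<close>, an elementary inequality for hyperbolic functions that holds for all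
  \<open>w \<ge> 0\<close> (\<open>ma_var_ge_4_tau\<close>). The constant in the error term can be taken to be \<open>2 / \<rho>\<close>.

  The constants \<open>C\<^sub>k\<^sub>,\<^sub>l\<close> are identified with these closed forms by polynomial algebra. As the
  equation of the symbol is linear in \<open>w\<close>, a root determines \<open>w\<close>, and hence all quantities, as
  a rational function of \<open>u\<close> and the root; each identity then only has two free variables.
  Matrices are indexed from 0 below, so index \<open>i\<close> of the lemmas is \<open>i + 1\<close> in the statement.
\<close>

section \<open>Tridiagonal matrices, the filter matrix, and congruences\<close>

definition tridiag_mat :: "nat \<Rightarrow> (nat \<Rightarrow> real) \<Rightarrow> (nat \<Rightarrow> real) \<Rightarrow> real mat" where
  "tridiag_mat n d e = mat n n (\<lambda>(i, j).
     if i = j then d i else if j = Suc i then e i else if i = Suc j then e j else 0)"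

text \<open>Half the entries come from a solution \<open>f\<close> on the left of the source, half from a
  solution \<open>g\<close> on the right: this is a discrete Green function with Wronskian \<open>W\<close>.\<close>

definition green_mat :: "nat \<Rightarrow> (nat \<Rightarrow> real) \<Rightarrow> (nat \<Rightarrow> real) \<Rightarrow> real \<Rightarrow> real mat" where
  "green_mat n f g W = mat n n (\<lambda>(i, j). f (min i j) * g (max i j) / W)"

lemma tridiag_row_sum:
  assumes "i < n"
  shows "(\<Sum>j<n. tridiag_mat n d e $$ (i, j) * h j) =
    (if 0 < i then e (i - 1) * h (i - 1) else 0) + d i * h i + (if Suc i < n then e i * h (Suc i) else 0)"
proof -
  have "tridiag_mat n d e $$ (i, j) * h j = (if j = i then d i * h i else 0)
      + (if j = Suc i then e i * h (Suc i) else 0)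
      + (if j = i - 1 then (if 0 < i then e (i - 1) * h (i - 1) else 0) else 0)" if "j < n" for j
    using assms that by (auto simp: tridiag_mat_def)
  then have "(\<Sum>j<n. tridiag_mat n d e $$ (i, j) * h j) = (\<Sum>j<n. (if j = i then d i * h i else 0)
      + (if j = Suc i then e i * h (Suc i) else 0)
      + (if j = i - 1 then (if 0 < i then e (i - 1) * h (i - 1) else 0) else 0))"
    by simp
  also have "\<dots> = d i * h i + (if Suc i < n then e i * h (Suc i) else 0)
      + (if 0 < i then e (i - 1) * h (i - 1) else 0)"
    using assms by (simp add: sum.distrib)
  finally show ?thesis by simp
qed

text \<open>Off the diagonal, a column of the Green function solves the recurrence because it is a
  multiple of \<open>f\<close> above the source and of \<open>g\<close> below it. On the diagonal, the recurrence for
  \<open>f\<close> turns the defect into the Wronskian. Setting \<open>g n = 0\<close> is the right boundary condition.\<close>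

lemma tridiag_green_inverse:
  assumes f_0: "d 0 * f 0 + e 0 * f 1 = 0"
    and f_rec: "\<And>k. 1 \<le> k \<Longrightarrow> k < n \<Longrightarrow> e (k - 1) * f (k - 1) + d k * f k + e k * f (Suc k) = 0"
    and g_rec: "\<And>k. 1 \<le> k \<Longrightarrow> k < n \<Longrightarrow> e (k - 1) * g (k - 1) + d k * g k + e k * g (Suc k) = 0"
    and g_n: "g n = 0"
    and wronskian: "\<And>k. k < n \<Longrightarrow> e k * (f k * g (Suc k) - f (Suc k) * g k) = W"
    and "W \<noteq> 0"
  shows "tridiag_mat n d e * green_mat n f g W = 1\<^sub>m n"
proof (rule eq_matI)
  fix i j assume "i < dim_row (1\<^sub>m n :: real mat)" "j < dim_col (1\<^sub>m n :: real mat)"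
  then have i: "i < n" and j: "j < n" by auto
  define h where "h k = f (min k j) * g (max k j) / W" for k
  have "(tridiag_mat n d e * green_mat n f g W) $$ (i, j)
      = (\<Sum>k<n. tridiag_mat n d e $$ (i, k) * h k)"
    using i j by (simp add: tridiag_mat_def green_mat_def scalar_prod_def h_def lessThan_atLeast0)
  also have "\<dots> = (if 0 < i then e (i - 1) * h (i - 1) else 0) + d i * h i + (if Suc i < n then e i * h (Suc i) else 0)"
    by (rule tridiag_row_sum[OF i])
  also have "(if Suc i < n then e i * h (Suc i) else 0) = e i * h (Suc i)"
    using i j g_n by (auto simp: h_def max_def le_less_Suc_eq dest: less_antisym)
  also have "(if 0 < i then e (i - 1) * h (i - 1) else 0) + d i * h i + e i * h (Suc i) = (if i = j then 1 else 0)"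
  proof -
    consider "i < j" | "i = j" | "j < i" by linarith
    then show ?thesis
    proof cases
      case 1
      have hf: "h k = f k * (g j / W)" if "k \<le> j" for k using that by (simp add: h_def)
      show ?thesis
      proof (cases "i = 0")
        case True
        then have "d i * h i + e i * h (Suc i) = (d 0 * f 0 + e 0 * f 1) * (g j / W)"
          using 1 by (simp add: hf algebra_simps)
        then show ?thesis using True 1 f_0 by simp
      next
        case False
        then have "e (i - 1) * h (i - 1) + d i * h i + e i * h (Suc i)
            = (e (i - 1) * f (i - 1) + d i * f i + e i * f (Suc i)) * (g j / W)"
          using 1 by (simp add: hf algebra_simps)
        then show ?thesis using False 1 f_rec[of i] i by simp
      qed
    next
      case 3
      have hg: "h k = g k * (f j / W)" if "j \<le> k" for k using that by (simp add: h_def)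
      have "e (i - 1) * h (i - 1) + d i * h i + e i * h (Suc i)
            = (e (i - 1) * g (i - 1) + d i * g i + e i * g (Suc i)) * (f j / W)"
        using 3 by (simp add: hg algebra_simps)
      then show ?thesis using 3 g_rec[of i] i by simp
    next
      case 2
      have hf: "h k = f k * (g j / W)" if "k \<le> j" for k using that by (simp add: h_def)
      have hS: "h (Suc j) = f j * g (Suc j) / W" using 2 by (simp add: h_def)
      have "(if 0 < i then e (i - 1) * h (i - 1) else 0) + d i * h i = - e i * f (Suc i) * (g j / W)"
      proof (cases "i = 0")
        case True
        have "d 0 * f 0 = - e 0 * f 1" using f_0 by simp
        then have "d 0 * f 0 * (g 0 / W) = - e 0 * f 1 * (g 0 / W)" by simp
        then show ?thesis using True 2 by (simp add: hf mult.assoc)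
      next
        case False
        have "e (i - 1) * f (i - 1) + d i * f i = - e i * f (Suc i)" using f_rec[of i] False i by simp
        then have "(e (i - 1) * f (i - 1) + d i * f i) * (g j / W) = - e i * f (Suc i) * (g j / W)" by simp
        then show ?thesis using False 2 by (simp add: hf algebra_simps)
      qed
      then have "(if 0 < i then e (i - 1) * h (i - 1) else 0) + d i * h i + e i * h (Suc i)
          = e j * (f j * g (Suc j) - f (Suc j) * g j) / W"
        using 2 by (simp add: hS diff_divide_distrib right_diff_distrib mult.assoc)
      then show ?thesis using wronskian[OF j] 2 \<open>W \<noteq> 0\<close> by simp
    qed
  qed
  finally show "(tridiag_mat n d e * green_mat n f g W) $$ (i, j) = 1\<^sub>m n $$ (i, j)"
    using i j by simp
qed (auto simp: tridiag_mat_def green_mat_def)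

text \<open>The first two rows are those of the identity, since there are no two predecessors to filter
  with.\<close>

definition whitening_mat :: "nat \<Rightarrow> real \<Rightarrow> real mat" where
  "whitening_mat n u = mat n n (\<lambda>(i, j).
     if i = j then 1 else if 2 \<le> i \<and> i = Suc j then - 2 * u else if i = Suc (Suc j) then u ^ 2 else 0)"

lemma whitening_row_sum:
  assumes "i < n"
  shows "(\<Sum>j<n. whitening_mat n u $$ (i, j) * h j) =
    (if 2 \<le> i then h i - 2 * u * h (i - 1) + u ^ 2 * h (i - 2) else h i)"
proof -
  have "whitening_mat n u $$ (i, j) * h j = (if j = i then h i else 0)
      + (if j = i - 1 then (if 2 \<le> i then - 2 * u * h (i - 1) else 0) else 0)
      + (if j = i - 2 then (if 2 \<le> i then u ^ 2 * h (i - 2) else 0) else 0)" if "j < n" for j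
    using assms that by (auto simp: whitening_mat_def)
  then have "(\<Sum>j<n. whitening_mat n u $$ (i, j) * h j) = (\<Sum>j<n. (if j = i then h i else 0)
      + (if j = i - 1 then (if 2 \<le> i then - 2 * u * h (i - 1) else 0) else 0)
      + (if j = i - 2 then (if 2 \<le> i then u ^ 2 * h (i - 2) else 0) else 0))"
    by simp
  also have "\<dots> = (if 2 \<le> i then h i - 2 * u * h (i - 1) + u ^ 2 * h (i - 2) else h i)"
    using assms by (auto simp: sum.distrib)
  finally show ?thesis .
qed

text \<open>The transposed filter looks ahead by two steps. Column 0 is excluded because row 1 is not
  filtered.\<close>

lemma whitening_col_sum:
  assumes "1 \<le> j" "j < n"
  shows "(\<Sum>i<n. whitening_mat n u $$ (i, j) * h i) =
    h j + (if j + 1 < n then - 2 * u * h (j + 1) else 0) + (if j + 2 < n then u ^ 2 * h (j + 2) else 0)"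
proof -
  have "whitening_mat n u $$ (i, j) * h i = (if i = j then h j else 0)
      + (if i = j + 1 then - 2 * u * h (j + 1) else 0)
      + (if i = j + 2 then u ^ 2 * h (j + 2) else 0)" if "i < n" for i
    using assms that by (auto simp: whitening_mat_def)
  then have "(\<Sum>i<n. whitening_mat n u $$ (i, j) * h i) = (\<Sum>i<n. (if i = j then h j else 0)
      + (if i = j + 1 then - 2 * u * h (j + 1) else 0)
      + (if i = j + 2 then u ^ 2 * h (j + 2) else 0))"
    by simp
  also have "\<dots> = h j + (if j + 1 < n then - 2 * u * h (j + 1) else 0) + (if j + 2 < n then u ^ 2 * h (j + 2) else 0)"
    using assms by (simp add: sum.distrib)
  finally show ?thesis .
qed

lemma sandwich_entry:
  fixes A B C :: "real mat"
  assumes "A \<in> carrier_mat n n" "B \<in> carrier_mat n n" "C \<in> carrier_mat n n" "i < n" "j < n"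
  shows "(A * B * C) $$ (i, j) = (\<Sum>k<n. A $$ (i, k) * (\<Sum>l<n. C $$ (l, j) * B $$ (k, l)))"
proof -
  have "(A * B * C) $$ (i, j) = (A * (B * C)) $$ (i, j)" using assms by (simp add: assoc_mult_mat[of A n n B n C n])
  also have "\<dots> = (\<Sum>k<n. A $$ (i, k) * (\<Sum>l<n. C $$ (l, j) * B $$ (k, l)))"
    using assms by (auto simp: scalar_prod_def lessThan_atLeast0 mult.commute intro!: sum.cong)
  finally show ?thesis .
qed

text \<open>Since the matrices are square, the one-sided inverse
  \<open>(T R) (T\<^sup>T G) = 1\<close> can be commuted, and a two-sided inverse is the one that
  \<^const>\<open>mat_inverse\<close> returns.\<close>

lemma congruence_inverse:
  fixes R T M G :: "real mat"
  assumes car: "R \<in> carrier_mat n n" "T \<in> carrier_mat n n" "G \<in> carrier_mat n n"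
    and M: "T * R * transpose_mat T = M" and MG: "M * G = 1\<^sub>m n"
  shows "invertible_mat R" "the (mat_inverse R) = transpose_mat T * G * T"
proof -
  let ?B = "transpose_mat T * G * T"
  have B: "?B \<in> carrier_mat n n" using car by simp
  have "(T * R) * (transpose_mat T * G) = 1\<^sub>m n"
    using MG car unfolding M[symmetric] by (simp add: assoc_mult_mat[of _ n n _ n _ n])
  then have "(transpose_mat T * G) * (T * R) = 1\<^sub>m n"
    using car by (intro mat_mult_left_right_inverse[of "T * R" n]) auto
  then have BR: "?B * R = 1\<^sub>m n" using car by (simp add: assoc_mult_mat[of _ n n _ n _ n])
  then have RB: "R * ?B = 1\<^sub>m n" using mat_mult_left_right_inverse[OF B car(1)] by simp
  show "invertible_mat R"
    using BR RB car B by (auto simp: invertible_mat_def inverts_mat_def square_mat.simps)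
  obtain C where C: "mat_inverse R = Some C"
  proof (cases "mat_inverse R")
    case None
    then have "R \<notin> Units (ring_mat TYPE(real) n ())" using mat_inverse(1)[OF car(1), of "()"] by blast
    moreover have "R \<in> Units (ring_mat TYPE(real) n ())"
      unfolding Units_def using car B BR RB by (auto simp: ring_mat_def)
    ultimately show ?thesis by simp
  qed auto
  then have CR: "C * R = 1\<^sub>m n" "C \<in> carrier_mat n n" using mat_inverse(2)[OF car(1)] by auto
  have "C = C * (R * ?B)" using RB CR by simp
  also have "\<dots> = C * R * ?B" by (rule assoc_mult_mat[symmetric, OF CR(2) car(1) B])
  also have "\<dots> = ?B" unfolding CR(1) using B by (rule left_mult_one_mat)
  finally show "the (mat_inverse R) = ?B" using C by simp
qed

section \<open>Filtering makes the covariance matrix tridiagonal\<close>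

text \<open>The variance of the filtered process, which is a moving average of order one; its lag-one
  autocovariance is \<^const>\<open>tau_m1\<close>.\<close>

definition ma_var :: "real \<Rightarrow> real" where
  "ma_var w = (let u = exp (- w) in 1 - 4 * w * u ^ 2 - u ^ 4)"

lemma coef_a_ma_var: "coef_a w = ma_var w + 2 * tau_m1 w * exp (- w)"
  unfolding coef_a_def ma_var_def tau_m1_def Let_def by Groebner_Basis.algebra

definition matern_cov :: "real \<Rightarrow> nat \<Rightarrow> nat \<Rightarrow> real" where
  "matern_cov w k l = (1 + real (nat \<bar>int k - int l\<bar>) * w) * exp (- w) ^ nat \<bar>int k - int l\<bar>"

lemma Rmat_matern_cov: "Rmat \<theta> n = mat n n (\<lambda>(k, l). matern_cov (\<theta> / real n) k l)"
  by (simp add: Rmat_def matern_cov_def)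

lemma matern_cov_sym: "matern_cov w k l = matern_cov w l k"
  by (simp add: matern_cov_def abs_minus_commute)

lemma matern_cov_add: "matern_cov w k (k + m) = (1 + real m * w) * exp (- w) ^ m"
  by (simp add: matern_cov_def)

text \<open>The covariance of a filtered variable with the unfiltered variables at least two steps before
  it vanishes, because \<open>(1 + m w) u\<^sup>m\<close> solves the recurrence with double characteristic root \<open>u\<close>.
  Filtering the second index first therefore leaves at most two non-zero entries on and above the
  diagonal in each column from the third on, to which the filter in the first index is applied.
  The part below the diagonal follows by symmetry.\<close>

lemma whitened_cov:
  fixes w :: real and n :: nat
  defines "u \<equiv> exp (- w)"
  defines "R \<equiv> mat n n (\<lambda>(k, l). matern_cov w k l)"
  shows "whitening_mat n u * R * transpose_mat (whitening_mat n u) =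
    tridiag_mat n (\<lambda>k. if k < 2 then 1 else ma_var w) (\<lambda>k. if k = 0 then (1 + w) * u else tau_m1 w)"
    (is "?L = ?M")
proof -
  let ?T = "whitening_mat n u"
  define B where "B k j = (if 2 \<le> j then matern_cov w k j - 2 * u * matern_cov w k (j - 1) + u ^ 2 * matern_cov w k (j - 2) else matern_cov w k j)" for k j
  define F where "F i j = (if 2 \<le> i then B i j - 2 * u * B (i - 1) j + u ^ 2 * B (i - 2) j else B i j)" for i j
  have T: "?T \<in> carrier_mat n n" by (simp add: whitening_mat_def)
  have entry: "?L $$ (i, j) = F i j" if "i < n" "j < n" for i j
  proof -
    have "?L $$ (i, j) = (\<Sum>k<n. ?T $$ (i, k) * (\<Sum>l<n. transpose_mat ?T $$ (l, j) * R $$ (k, l)))"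
      using T that by (intro sandwich_entry) (auto simp: R_def)
    also have "\<dots> = (\<Sum>k<n. ?T $$ (i, k) * (\<Sum>l<n. ?T $$ (j, l) * matern_cov w k l))"
      using T that by (intro sum.cong refl arg_cong2[of _ _ _ _ "(*)"]) (auto simp: R_def)
    also have "\<dots> = (\<Sum>k<n. ?T $$ (i, k) * B k j)"
      using that by (simp add: whitening_row_sum B_def)
    also have "\<dots> = F i j" using that by (simp add: whitening_row_sum F_def)
    finally show ?thesis .
  qed
  have F_sym: "F i j = F j i" for i j
    unfolding F_def B_def using matern_cov_sym[of w] by (simp add: algebra_simps)
  have B_0: "B k j = 0" if "k + 2 \<le> j" for k j
  proof -
    define m where "m = j - k - 2"
    have j: "j = k + (m + 2)" "j - 1 = k + (m + 1)" "j - 2 = k + m" using that by (auto simp: m_def)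
    have "matern_cov w k j = (1 + real (m + 2) * w) * u ^ (m + 2)"
      "matern_cov w k (j - 1) = (1 + real (m + 1) * w) * u ^ (m + 1)" "matern_cov w k (j - 2) = (1 + real m * w) * u ^ m"
      by (fact matern_cov_add[of w k "m + 2", folded j(1) u_def] matern_cov_add[of w k "m + 1", folded j(2) u_def]
          matern_cov_add[of w k m, folded j(3) u_def])+
    then show ?thesis using that unfolding B_def by (simp add: power_add algebra_simps eval_nat_numeral)
  qed
  have B_1: "B k (Suc k) = tau_m1 w" if "1 \<le> k" for k
  proof -
    have "matern_cov w k (Suc k) = (1 + w) * u" "matern_cov w k k = 1" "matern_cov w k (k - 1) = (1 + w) * u"
      using matern_cov_add[of w k 1] matern_cov_add[of w k 0] matern_cov_add[of w "k - 1" 1] that matern_cov_sym[of w k "k - 1"] by (auto simp: u_def)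
    then show ?thesis using that unfolding B_def tau_m1_def u_def Let_def by (simp add: algebra_simps eval_nat_numeral)
  qed
  have B_2: "B k k = coef_a w" if "2 \<le> k" for k
  proof -
    have "matern_cov w k k = 1" "matern_cov w k (k - 1) = (1 + w) * u" "matern_cov w k (k - 2) = (1 + 2 * w) * u ^ 2"
      using matern_cov_add[of w k 0] matern_cov_add[of w "k - 1" 1] matern_cov_add[of w "k - 2" 2, unfolded le_add_diff_inverse2[OF that]]
        that matern_cov_sym[of w k "k - 1"] matern_cov_sym[of w k "k - 2"] by (auto simp: u_def simp del: add_2_eq_Suc')
    then show ?thesis using that unfolding B_def coef_a_def u_def Let_def by (simp add: algebra_simps eval_nat_numeral)
  qed
  have upper: "F i j = ?M $$ (i, j)" if ij: "i \<le> j" "i < n" "j < n" for i j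
  proof -
    consider "i + 2 \<le> j" | "j = Suc i" | "j = i" using ij(1) by linarith
    then show ?thesis
    proof cases
      case 1
      then show ?thesis using ij by (simp add: F_def B_0 tridiag_mat_def)
    next
      case 2
      then show ?thesis
      proof (cases "i = 0")
        case True
        have "F 0 1 = (1 + w) * u" using matern_cov_add[of w 0 1] by (simp add: F_def B_def u_def)
        then show ?thesis using True 2 ij by (simp add: tridiag_mat_def)
      next
        case False
        then show ?thesis using 2 ij by (simp add: F_def B_0 B_1 tridiag_mat_def)
      qed
    next
      case 3
      show ?thesis
      proof (cases "i < 2")
        case True
        then show ?thesis using 3 ij matern_cov_add[of w i 0] by (simp add: F_def B_def tridiag_mat_def)
      next
        case False
        have "F i i = B i i - 2 * u * B (i - 1) (Suc (i - 1)) + u ^ 2 * B (i - 2) i" using False by (simp add: F_def)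
        also have "\<dots> = ma_var w" using False by (simp only: B_1 B_2 B_0) (simp add: coef_a_ma_var u_def)
        finally show ?thesis using 3 ij False by (simp add: tridiag_mat_def)
      qed
    qed
  qed
  show ?thesis
  proof (rule eq_matI)
    fix i j assume "i < dim_row ?M" "j < dim_col ?M"
    then have ij: "i < n" "j < n" by (auto simp: tridiag_mat_def)
    show "?L $$ (i, j) = ?M $$ (i, j)"
    proof (cases "i \<le> j")
      case True
      then show ?thesis using upper entry ij by simp
    next
      case False
      have "?M $$ (i, j) = ?M $$ (j, i)" using ij by (auto simp: tridiag_mat_def)
      then show ?thesis using upper[of j i] entry ij F_sym[of i j] False by simp
    qed
  qed (auto simp: tridiag_mat_def whitening_mat_def R_def)
qed

section \<open>The constants at a root of the symbol\<close>

text \<open>After division by \<open>u\<^sup>2\<close> this is a function vanishing at 0 with derivative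
  \<open>2 w sinh w\<close>.\<close>

lemma tau_m1_pos:
  fixes w :: real
  assumes "0 < w"
  shows "0 < tau_m1 w"
proof -
  define f where "f x = (x - 1) * exp x + (1 + x) * exp (- x)" for x :: real
  have "f 0 < f w"
  proof (rule DERIV_pos_imp_increasing_open[OF assms])
    fix x :: real assume "0 < x"
    have "(f has_real_derivative x * (exp x - exp (- x))) (at x)"
      unfolding f_def by (auto intro!: derivative_eq_intros simp: algebra_simps)
    moreover have "0 < x * (exp x - exp (- x))" using \<open>0 < x\<close> by simp
    ultimately show "\<exists>y. (f has_real_derivative y) (at x) \<and> 0 < y" by blast
  qed (auto simp: f_def intro!: continuous_intros)
  moreover have "tau_m1 w = exp (- w) ^ 2 * f w"
    by (simp add: tau_m1_def Let_def f_def algebra_simps eval_nat_numeral flip: exp_add)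
  ultimately show ?thesis by (simp add: f_def)
qed

text \<open>The symbol is linear in \<open>w\<close> apart from \<open>u\<close>, so that a root \<open>z\<close> parametrises \<open>w\<close>
  rationally by \<open>u\<close> and \<open>z\<close>. As both roots are negative, the common denominator of this
  parametrisation is positive. The locale is used for each of the two roots.\<close>

locale symbol_root =
  fixes w u z :: real
  assumes w_pos: "0 < w" and u_def: "u = exp (- w)" and z_neg: "z < 0"
    and root: "tau_m1 w * z ^ 2 + ma_var w * z + tau_m1 w = 0"
begin

definition den :: real where "den = (1 + u ^ 2) * (z ^ 2 + 1) - 4 * u * z"

lemma u_bounds: "0 < u" "u < 1"
  using w_pos by (auto simp: u_def)

lemma den_pos: "0 < den"
proof -
  have "0 < (1 + u ^ 2) * (z ^ 2 + 1)" by (intro mult_pos_pos add_pos_nonneg add_nonneg_pos) auto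
  moreover have "4 * u * z < 0" using u_bounds z_neg by (simp add: mult_pos_neg)
  ultimately show ?thesis unfolding den_def by linarith
qed

lemma tau_eq: "tau_m1 w = (w - 1) * u + (1 + w) * u ^ 3"
  by (simp add: tau_m1_def u_def Let_def)

lemma ma_var_eq: "ma_var w = 1 - 4 * w * u ^ 2 - u ^ 4"
  by (simp add: ma_var_def u_def Let_def)

lemma nonzero: "u \<noteq> 0" "z \<noteq> 0" "z - u \<noteq> 0" "den \<noteq> 0" "1 - u ^ 2 \<noteq> 0"
  using u_bounds z_neg den_pos by (auto simp: power2_eq_1_iff)

lemma w_param: "w = (1 - u ^ 2) * (u * z - 1) * (z - u) / (u * den)"
proof -
  have "w * (u * den) = (1 - u ^ 2) * (u * z - 1) * (z - u)"
    using root unfolding tau_eq ma_var_eq den_def by Groebner_Basis.algebra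
  then show ?thesis using nonzero by (simp add: field_simps)
qed

lemma tau_param: "tau_m1 w = - z * (1 - u ^ 2) ^ 3 / den"
proof -
  have "w * (u * den) = (1 - u ^ 2) * (u * z - 1) * (z - u)"
    using w_param nonzero by simp
  then have "tau_m1 w * den = - z * (1 - u ^ 2) ^ 3"
    unfolding tau_eq den_def by Groebner_Basis.algebra
  then show ?thesis using nonzero by (simp add: field_simps)
qed

lemma tau_pos: "0 < tau_m1 w"
  using w_pos by (rule tau_m1_pos)

definition w_quot :: real where "w_quot = (1 - u ^ 2) * (u * z - 1) / (u * den)"

lemma w_eq_quot: "w = w_quot * (z - u)"
  using w_param by (simp add: w_quot_def)

lemma X_eq: "X_of w (u * z) = tau_m1 w * (z - u)"
proof -
  have "coef_b w + tau_m1 w * u = u ^ 2 + w - 1 + w * u ^ 2"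
    unfolding coef_b_def tau_eq u_def[symmetric] Let_def by Groebner_Basis.algebra
  moreover have "(u ^ 2 + w - 1 + w * u ^ 2) * (u * z) - tau_m1 w * u = tau_m1 w * (z - u)"
    unfolding tau_eq by Groebner_Basis.algebra
  ultimately show ?thesis by (simp add: X_of_def u_def)
qed

lemma tau_family_eqs:
  "tauhat_m1 w = (1 + w) * u - 3 * (1 + w) * u ^ 3 + 2 * (1 + 2 * w) * u ^ 5"
  "tauhat w 0 = 1 - 3 * (1 + 2 * w) * u ^ 4 + 2 * (1 + 3 * w) * u ^ 6"
  "tauhat w 1 = (1 + w) * u - 3 * (1 + 3 * w) * u ^ 5 + 2 * (1 + 4 * w) * u ^ 7"
  "tautil_m2 w = tau_m1 w * u / 2"
  "tautil_m1 w = ((2 * w - 1) * u + (1 + 2 * w) * u ^ 5) / 2"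
  "tautil w 0 = (2 - 3 * (1 + w) * u ^ 2 + (1 + 3 * w) * u ^ 6) / 2"
  by (simp_all add: tauhat_m1_def tauhat_def tautil_m2_def tautil_m1_def tautil_def u_def Let_def power2_eq_square)

text \<open>The next five lemmas clear denominators, using that \<^const>\<open>X_of\<close> is
  \<open>\<tau> (z - u)\<close> and that \<open>w\<close> has a factor \<open>z - u\<close> as well, and then compare two rational
  functions of \<open>u\<close> and \<open>z\<close>. The two expressions defined here, and with them the right-hand sides of
  the last four lemmas, are what results from solving the two linear equations in \<open>diag_K\<close>
  (respectively \<open>superdiag_K\<close>) for the two constants.\<close>

definition C1_poly :: real where
  "C1_poly = (1 - u * z) ^ 2 * ((z ^ 2 + 1 - u * z) ^ 2 - z ^ 2) / z ^ 2
     - u ^ 2 * z ^ 2 * (z ^ 2 + 1) + 2 * u * (1 + u ^ 2) * z ^ 3"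

definition C4_poly :: real where
  "C4_poly = u ^ 2 * z ^ 3 - (1 - u * z) ^ 2 * (z ^ 2 - 2 * u * z + 1) / z"

lemma C6_root: "C6 w (u * z) = tau_m1 w ^ 2 * (1 - u * z) ^ 2"
proof -
  define t h1 h0 s2 s1 v where "t = tau_m1 w"
    and "h1 = tauhat_m1 w"
    and "h0 = tauhat w 0"
    and "s2 = tautil_m2 w"
    and "s1 = tautil_m1 w"
    and "v = z - u"
  note defs = h1_def h0_def s2_def s1_def
  have v: "v \<noteq> 0" and t: "t \<noteq> 0" using nonzero tau_pos by (auto simp: v_def t_def)
  have wv: "w = w_quot * v" using w_eq_quot by (simp add: v_def)
  have "C6 w (u * z) * v =
      (h1 * s1 - h0 * s2) * v
      + 2 * u ^ 2 * s1 * (w * (1 - 4 * u ^ 2 + 3 * u ^ 4) + (1 - u ^ 2) ^ 2)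
      - 2 * u ^ 3 * s2 * (w * (2 - 6 * u ^ 2 + 4 * u ^ 4) + (1 - u ^ 2) ^ 2)
      + 2 * w_quot * u ^ 3 * (s1 - u * s2) * (1 - u ^ 2) ^ 2"
    unfolding C6_def Let_def X_eq tauhat_m2_def u_def[symmetric] v_def[symmetric] t_def[symmetric]
      defs[symmetric] unfolding wv
    using v t nonzero(1) by (simp add: divide_simps eval_nat_numeral)
  also have "\<dots> = t ^ 2 * (1 - u * z) ^ 2 * v"
    unfolding defs tau_family_eqs t_def v_def unfolding tau_param unfolding w_param w_quot_def
    using nonzero by (simp add: divide_simps) (unfold den_def, Groebner_Basis.algebra)
  finally show ?thesis using v by (simp add: t_def)
qed

lemma C1_root: "C1 w (u * z) = tau_m1 w / u ^ 4 * C1_poly"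
proof -
  define t h0 hp1 s1 s0 v where "t = tau_m1 w"
    and "h0 = tauhat w 0"
    and "hp1 = tauhat w 1"
    and "s1 = tautil_m1 w"
    and "s0 = tautil w 0"
    and "v = z - u"
  note defs = h0_def hp1_def s1_def s0_def
  have v: "v \<noteq> 0" and t: "t \<noteq> 0" using nonzero tau_pos by (auto simp: v_def t_def)
  have wv: "w = w_quot * v" using w_eq_quot by (simp add: v_def)
  have "C1 w (u * z) * (t * u ^ 4 * v) =
      2 * s0 * u ^ 3 * (w * (2 - 6 * u ^ 2 + 4 * u ^ 4) + (1 - u ^ 2) ^ 2)
      + 2 * w_quot * s0 * u ^ 4 * (1 - u ^ 2) ^ 2 + (h0 * s0 - hp1 * s1) * v
      - 2 * s1 * u ^ 4 * (w * (3 - 8 * u ^ 2 + 5 * u ^ 4) + (1 - u ^ 2) ^ 2)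
      - 2 * w_quot * u ^ 5 * s1 * (1 - u ^ 2) ^ 2"
    unfolding C1_def Let_def X_eq tauhat_m2_def u_def[symmetric] v_def[symmetric] t_def[symmetric]
      defs[symmetric] unfolding wv
    using v t nonzero(1) by (simp add: divide_simps eval_nat_numeral) Groebner_Basis.algebra
  also have "\<dots> = t / u ^ 4 * C1_poly * (t * u ^ 4 * v)"
    unfolding defs tau_family_eqs t_def v_def C1_poly_def unfolding tau_param unfolding w_param w_quot_def
    using nonzero by (simp add: divide_simps) (unfold den_def, Groebner_Basis.algebra)
  finally have *: "C1 w (u * z) * (t * u ^ 4 * v) =
      t / u ^ 4 * C1_poly * (t * u ^ 4 * v)" .
  have "t * u ^ 4 * v \<noteq> 0" using v t nonzero(1) by simp
  from mult_right_cancel[OF this, THEN iffD1, OF *] show ?thesis by (simp add: t_def)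
qed

lemma C2_root: "C2 w (u * z) = tau_m1 w / u ^ 5 * ((1 - u * z) ^ 4 / z ^ 3 - C1_poly * (1 - u * z) / z)"
proof -
  define t h0 s1 v where "t = tau_m1 w"
    and "h0 = tauhat w 0"
    and "s1 = tautil_m1 w"
    and "v = z - u"
  note defs = h0_def s1_def
  have v: "v \<noteq> 0" and t: "t \<noteq> 0" using nonzero tau_pos by (auto simp: v_def t_def)
  have wv: "w = w_quot * v" using w_eq_quot by (simp add: v_def)
  have "C2 w (u * z) * (t * u ^ 4 * v) =
      w * (2 - 3 * u ^ 2 + u ^ 6) * (w * (2 - 6 * u ^ 2 + 4 * u ^ 4) + (1 - u ^ 2) ^ 2) * u ^ 3
      + w * w_quot * (2 - 3 * u ^ 2 + u ^ 6) * (1 - u ^ 2) ^ 2 * u ^ 4 + w * h0 * (2 - 3 * u ^ 2 + u ^ 6) * v / 2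
      - 2 * w * (1 - u ^ 2) ^ 2 * s1 * u ^ 4 - w * (1 - 3 * u ^ 4 + 2 * u ^ 6) * s1 * u * v"
    unfolding C2_def Let_def X_eq tauhat_m2_def u_def[symmetric] v_def[symmetric] t_def[symmetric]
      defs[symmetric] unfolding wv
    using v t nonzero(1) by (simp add: divide_simps eval_nat_numeral) Groebner_Basis.algebra
  also have "\<dots> = t / u ^ 5 * ((1 - u * z) ^ 4 / z ^ 3 - C1_poly * (1 - u * z) / z) * (t * u ^ 4 * v)"
    unfolding defs tau_family_eqs t_def v_def C1_poly_def unfolding tau_param unfolding w_param w_quot_def
    using nonzero by (simp add: divide_simps) (unfold den_def, Groebner_Basis.algebra)
  finally have *: "C2 w (u * z) * (t * u ^ 4 * v) =
      t / u ^ 5 * ((1 - u * z) ^ 4 / z ^ 3 - C1_poly * (1 - u * z) / z) * (t * u ^ 4 * v)" .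
  have "t * u ^ 4 * v \<noteq> 0" using v t nonzero(1) by simp
  from mult_right_cancel[OF this, THEN iffD1, OF *] show ?thesis by (simp add: t_def)
qed

lemma C4_root: "C4 w (u * z) = tau_m1 w / u ^ 4 * C4_poly"
proof -
  define t h1 hp1 s2 s0 v where "t = tau_m1 w"
    and "h1 = tauhat_m1 w"
    and "hp1 = tauhat w 1"
    and "s2 = tautil_m2 w"
    and "s0 = tautil w 0"
    and "v = z - u"
  note defs = h1_def hp1_def s2_def s0_def
  have v: "v \<noteq> 0" and t: "t \<noteq> 0" using nonzero tau_pos by (auto simp: v_def t_def)
  have wv: "w = w_quot * v" using w_eq_quot by (simp add: v_def)
  have "C4 w (u * z) * (t * u ^ 4 * v) =
      h1 * s0 * v + 2 * s0 * u ^ 2 * (w * (1 - 4 * u ^ 2 + 3 * u ^ 4) + (1 - u ^ 2) ^ 2)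
      + 2 * w_quot * u ^ 3 * s0 * (1 - u ^ 2) ^ 2 - hp1 * s2 * v
      - 2 * s2 * u ^ 4 * (w * (3 - 8 * u ^ 2 + 5 * u ^ 4) + (1 - u ^ 2) ^ 2)
      - 2 * w_quot * u ^ 5 * s2 * (1 - u ^ 2) ^ 2"
    unfolding C4_def Let_def X_eq tauhat_m2_def u_def[symmetric] v_def[symmetric] t_def[symmetric]
      defs[symmetric] unfolding wv
    using v t nonzero(1) by (simp add: divide_simps eval_nat_numeral)
  also have "\<dots> = t / u ^ 4 * C4_poly * (t * u ^ 4 * v)"
    unfolding defs tau_family_eqs t_def v_def C4_poly_def unfolding tau_param unfolding w_param w_quot_def
    using nonzero by (simp add: divide_simps) (unfold den_def, Groebner_Basis.algebra)
  finally have *: "C4 w (u * z) * (t * u ^ 4 * v) =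
      t / u ^ 4 * C4_poly * (t * u ^ 4 * v)" .
  have "t * u ^ 4 * v \<noteq> 0" using v t nonzero(1) by simp
  from mult_right_cancel[OF this, THEN iffD1, OF *] show ?thesis by (simp add: t_def)
qed

lemma C5_root: "C5 w (u * z) = tau_m1 w / u ^ 5 * (- ((1 - u * z) ^ 4) / z ^ 2 - C4_poly * (1 - u * z) / z)"
proof -
  define t h1 s2 v where "t = tau_m1 w"
    and "h1 = tauhat_m1 w"
    and "s2 = tautil_m2 w"
    and "v = z - u"
  note defs = h1_def s2_def
  have v: "v \<noteq> 0" and t: "t \<noteq> 0" using nonzero tau_pos by (auto simp: v_def t_def)
  have wv: "w = w_quot * v" using w_eq_quot by (simp add: v_def)
  have "C5 w (u * z) * (t * u ^ 4 * v) =
      w * h1 * (2 - 3 * u ^ 2 + u ^ 6) * v / 2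
      + w * (2 - 3 * u ^ 2 + u ^ 6) * u ^ 2 * (w * (1 - 4 * u ^ 2 + 3 * u ^ 4) + (1 - u ^ 2) ^ 2)
      + w * w_quot * (2 - 3 * u ^ 2 + u ^ 6) * (1 - u ^ 2) ^ 2 * u ^ 3
      - 2 * w * s2 * (1 - u ^ 2) ^ 2 * u ^ 4 - w * (1 - 3 * u ^ 4 + 2 * u ^ 6) * s2 * u * v"
    unfolding C5_def Let_def X_eq tauhat_m2_def u_def[symmetric] v_def[symmetric] t_def[symmetric]
      defs[symmetric] unfolding wv
    using v t nonzero(1) by (simp add: divide_simps eval_nat_numeral) Groebner_Basis.algebra
  also have "\<dots> = t / u ^ 5 * (- ((1 - u * z) ^ 4) / z ^ 2 - C4_poly * (1 - u * z) / z) * (t * u ^ 4 * v)"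
    unfolding defs tau_family_eqs t_def v_def C4_poly_def unfolding tau_param unfolding w_param w_quot_def
    using nonzero by (simp add: divide_simps) (unfold den_def, Groebner_Basis.algebra)
  finally have *: "C5 w (u * z) * (t * u ^ 4 * v) =
      t / u ^ 5 * (- ((1 - u * z) ^ 4) / z ^ 2 - C4_poly * (1 - u * z) / z) * (t * u ^ 4 * v)" .
  have "t * u ^ 4 * v \<noteq> 0" using v t nonzero(1) by simp
  from mult_right_cancel[OF this, THEN iffD1, OF *] show ?thesis by (simp add: t_def)
qed

text \<open>In the main term, \<^const>\<open>C1\<close> and \<^const>\<open>C2\<close> enter only through these two combinations at each
  root; \<open>1 / z\<close> is the other root. The first is the coefficient of the terms in which the
  contributions of the two roots meet, together with the correction on the diagonal band, the
  second that of the terms where the same root occurs twice.\<close>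

lemma diag_K:
  "C1 w (u * z) * (u * z - u ^ 2) + C2 w (u * z) * u ^ 2 = tau_m1 w * z ^ 3 / u ^ 3 *
     ((1 - u * z) ^ 2 * (1 - u / z) ^ 2 + (1 / z - z) * (u ^ 2 * (z + 1 / z) - 2 * u - 2 * u ^ 3))"
  "C1 w (u * z) * (u / z - u ^ 2) + C2 w (u * z) * u ^ 2 = tau_m1 w / (u ^ 3 * z ^ 3) * (1 - u * z) ^ 4"
  unfolding C1_root C2_root C1_poly_def using nonzero
  by (simp_all add: divide_simps, simp_all, Groebner_Basis.algebra+)

lemma superdiag_K:
  "C4 w (u * z) * (u * z - u ^ 2) + C5 w (u * z) * u ^ 2 = tau_m1 w * z ^ 3 / u ^ 3 *
     (- (1 / z) * (1 - u * z) ^ 2 * (1 - u / z) ^ 2 - u ^ 2 * (1 / z - z))"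
  "C4 w (u * z) * (u / z - u ^ 2) + C5 w (u * z) * u ^ 2 = tau_m1 w / (u ^ 3 * z ^ 3) * (- z * (1 - u * z) ^ 4)"
  unfolding C4_root C5_root C4_poly_def using nonzero
  by (simp_all add: divide_simps, simp_all, Groebner_Basis.algebra+)

end

section \<open>The two roots and their size\<close>

text \<open>With \<open>u\<^sup>2\<close> factored out, the claim becomes
  \<open>sinh w (cosh w + 2) \<ge> w (1 + 2 cosh w)\<close>. The inequality is sharp to fourth order at 0, which is
  why \<open>r\<close> tends to \<open>\<rho>\<close> from below: \<open>\<rho>\<close> is the square of the root \<open>-2 + sqrt 3\<close> of
  \<open>x\<^sup>2 + 4 x + 1\<close>.\<close>

lemma ma_var_ge_4_tau:
  fixes w :: real
  assumes "0 \<le> w"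
  shows "4 * tau_m1 w \<le> ma_var w"
proof -
  define f where "f x = sinh x * (cosh x + 2) - x * (1 + 2 * cosh x)" for x :: real
  have "f 0 \<le> f w"
  proof (rule DERIV_nonneg_imp_nondecreasing[OF assms])
    fix x :: real assume "0 \<le> x"
    have "(f has_real_derivative 2 * sinh x * (sinh x - x)) (at x)"
      unfolding f_def using hyperbolic_pythagoras[of x]
      by (auto intro!: derivative_eq_intros simp: algebra_simps power2_eq_square)
    moreover have "0 \<le> 2 * sinh x * (sinh x - x)"
    proof -
      have "x \<le> sinh x" using real_le_x_sinh[OF \<open>0 \<le> x\<close>] by (simp add: sinh_def exp_minus)
      then show ?thesis using \<open>0 \<le> x\<close> by (intro mult_nonneg_nonneg) auto
    qed
    ultimately show "\<exists>y. (f has_real_derivative y) (at x) \<and> 0 \<le> y" by blast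
  qed
  then have f: "0 \<le> f w" by (simp add: f_def)
  define u where "u = exp (- w)"
  define v where "v = exp w"
  have uv: "u * v = 1" by (simp add: u_def v_def exp_minus)
  have "ma_var w - 4 * tau_m1 w = 4 * u ^ 2 * f w"
    unfolding ma_var_def tau_m1_def f_def sinh_def cosh_def Let_def u_def[symmetric] v_def[symmetric] scaleR_conv_of_real
    using uv by (simp add: field_simps) Groebner_Basis.algebra
  moreover have "0 \<le> 4 * u ^ 2 * f w" using f by simp
  ultimately show ?thesis by linarith
qed

text \<open>The difference is \<open>u\<^sup>2 (u\<^sup>2 - (1 - w)\<^sup>2)\<close>, so this is the convexity bound
  \<open>exp (- w) \<ge> 1 - w\<close>; the restriction on \<open>w\<close> ensures that squaring preserves it.\<close>

lemma ma_var_le_coef_at: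
  assumes "0 \<le> w" "w \<le> 1"
  shows "ma_var w \<le> coef_at w"
proof -
  define u where "u = exp (- w)"
  have "1 - w \<le> u" using exp_ge_add_one_self[of "- w"] by (simp add: u_def)
  then have "(1 - w) ^ 2 \<le> u ^ 2" using assms by (intro power_mono) auto
  moreover have "coef_at w - ma_var w = u ^ 2 * (u ^ 2 - (1 - w) ^ 2)"
    unfolding coef_at_def ma_var_def Let_def u_def[symmetric] by Groebner_Basis.algebra
  moreover have "0 \<le> u ^ 2 * (u ^ 2 - (1 - w) ^ 2)" using calculation(1) by simp
  ultimately show ?thesis by linarith
qed

lemma coef_b_tau: "coef_b w + tau_m1 w * exp (- w) = tau_m1 w / exp (- w)"
proof -
  define u where "u = exp (- w)"
  have "u \<noteq> 0" by (simp add: u_def)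
  then show ?thesis
    unfolding coef_b_def tau_m1_def Let_def u_def[symmetric] by (simp add: field_simps) Groebner_Basis.algebra
qed

lemma coef_bt_tau: "coef_bt w = tau_m1 w / exp (- w)"
proof -
  define u where "u = exp (- w)"
  have "u \<noteq> 0" by (simp add: u_def)
  then show ?thesis
    unfolding coef_bt_def tau_m1_def Let_def u_def[symmetric] by (simp add: field_simps) Groebner_Basis.algebra
qed

text \<open>The last assumption states that the boundary term of the left solution is positive at the
  larger root in absolute value, hence at both.\<close>

locale spectrum =
  fixes w u y z :: real
  assumes w_pos: "0 < w" and u_def: "u = exp (- w)"
    and y_less_z: "y < z" and z_neg: "z < 0" and yz: "y * z = 1"
    and ma_var_roots: "ma_var w = - tau_m1 w * (y + z)"
    and alpha1_eq: "alpha1 w = u * y" and alpha2_eq: "alpha2 w = u * z"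
    and y_bound: "0 < coef_at w + tau_m1 w * y"

text \<open>By \<open>coef_b_tau\<close>, the equation defining \<open>\<alpha>\<^sub>1\<close> and \<open>\<alpha>\<^sub>2\<close> is that of the symbol scaled by
  \<open>u\<close>. The bound on \<open>z\<close> comes from \<open>z + 1 / z \<le> -4\<close>, which means that \<open>z \<ge> -2 + sqrt 3\<close>.\<close>

lemma spectrum_exists:
  assumes "0 < w" "w \<le> 1"
  obtains y z where "spectrum w (exp (- w)) y z" "z ^ 2 \<le> (2 - sqrt 3) / (2 + sqrt 3)"
proof -
  define u where "u = exp (- w)"
  have u: "u > 0" by (simp add: u_def)
  define t where "t = tau_m1 w"
  define g where "g = ma_var w"
  have t: "t > 0" using tau_m1_pos[OF assms(1)] by (simp add: t_def)
  have g: "4 * t \<le> g" using ma_var_ge_4_tau[of w] assms by (simp add: g_def t_def)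
  define s where "s = sqrt (g ^ 2 - 4 * t ^ 2)"
  have "(4 * t) ^ 2 \<le> g ^ 2" using t g by (intro power_mono) auto
  then have rad: "g ^ 2 - 4 * t ^ 2 \<ge> 12 * t ^ 2" by (simp add: power_mult_distrib)
  have t2: "0 < t ^ 2" using t by simp
  have rad_pos: "0 < g ^ 2 - 4 * t ^ 2" using rad t2 by linarith
  have s2: "s ^ 2 = g ^ 2 - 4 * t ^ 2" using rad_pos by (simp add: s_def)
  have s: "0 < s" using rad_pos by (simp add: s_def)
  have "s ^ 2 < g ^ 2" using s2 t2 by linarith
  then have sg: "s < g" using t g by (intro power_less_imp_less_base[of s 2 g]) auto
  define y where "y = (- g - s) / (2 * t)"
  define z where "z = (- g + s) / (2 * t)"
  have yz: "y * z = 1"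
  proof -
    have "y * z = (g ^ 2 - s ^ 2) / (4 * t ^ 2)" unfolding y_def z_def by (simp add: field_simps power2_eq_square)
    then show ?thesis using t s2 by simp
  qed
  have sum: "g = - t * (y + z)" unfolding y_def z_def using t by (simp add: field_simps)
  have less: "y < z" unfolding y_def z_def using t s by (simp add: divide_strict_right_mono)
  have neg: "z < 0" unfolding z_def using t sg by (simp add: divide_neg_pos)
  have a: "coef_a w - 2 * tau_m1 w * exp (- w) = g" by (simp add: coef_a_ma_var g_def)
  have rad_eq: "g ^ 2 - 4 * t * u * (t / u) = g ^ 2 - 4 * t ^ 2" using u by (simp add: power2_eq_square)
  have al1: "alpha1 w = u * y"
    unfolding alpha1_def Let_def coef_b_tau a unfolding t_def[symmetric] u_def[symmetric] rad_eq s_def[symmetric] y_def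
    using u t by (simp add: field_simps)
  have al2: "alpha2 w = u * z"
    unfolding alpha2_def Let_def coef_b_tau a unfolding t_def[symmetric] u_def[symmetric] rad_eq s_def[symmetric] z_def
    using u t by (simp add: field_simps)
  have "g \<le> coef_at w" using ma_var_le_coef_at[of w] assms by (simp add: g_def)
  then have yb: "0 < coef_at w + t * y"
    using sum mult_pos_neg[OF t neg] by (simp add: algebra_simps)
  have "spectrum w u y z"
    by unfold_locales (use assms u_def less neg yz sum al1 al2 yb in \<open>auto simp: g_def t_def\<close>)
  moreover have "z ^ 2 \<le> (2 - sqrt 3) / (2 + sqrt 3)"
  proof -
    have z1: "z > -1"
    proof (rule ccontr)
      assume "\<not> z > -1"
      then have "1 * 1 < (- y) * (- z)" using less neg by (intro mult_less_le_imp_less) auto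
      then show False using yz by simp
    qed
    have "t * 4 \<le> t * - (y + z)" using g sum by linarith
    then have "- (y + z) \<ge> 4" using t by (rule mult_left_le_imp_le)
    then have "- (y + z) * (- z) \<ge> 4 * (- z)" using neg by (intro mult_right_mono) auto
    then have "1 + z ^ 2 \<ge> - 4 * z" using yz by (simp add: algebra_simps power2_eq_square)
    then have "(z + 2) ^ 2 \<ge> sqrt 3 ^ 2" by (simp add: power2_eq_square algebra_simps)
    then have "sqrt 3 \<le> z + 2" using z1 by (auto intro: power2_le_imp_le[of "sqrt 3" "z + 2"])
    then have "(- z) ^ 2 \<le> (2 - sqrt 3) ^ 2" using neg by (intro power_mono) auto
    also have "(2 - sqrt 3) ^ 2 = (2 - sqrt 3) / (2 + sqrt (3::real))"
    proof -
      have "(2 - sqrt 3) ^ 2 * (2 + sqrt 3) = (2 - sqrt (3::real))"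
        by (simp add: power2_eq_square algebra_simps)
      moreover have "2 + sqrt (3::real) \<noteq> 0" using real_sqrt_ge_zero[of 3] by linarith
      ultimately show ?thesis by (simp add: field_simps)
    qed
    finally show ?thesis by simp
  qed
  ultimately show ?thesis using that by (simp add: u_def)
qed

section \<open>The inverse matrix in closed form\<close>

context spectrum
begin

lemma u_pos: "0 < u" by (simp add: u_def)

sublocale Y: symbol_root w u y
proof unfold_locales
  have "tau_m1 w * y ^ 2 + ma_var w * y + tau_m1 w = tau_m1 w * (1 - y * z)"
    unfolding ma_var_roots by (simp add: algebra_simps power2_eq_square)
  then show "tau_m1 w * y ^ 2 + ma_var w * y + tau_m1 w = 0" using yz by simp
qed (use w_pos u_def y_less_z z_neg in auto)

sublocale Z: symbol_root w u z
proof unfold_locales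
  have "tau_m1 w * z ^ 2 + ma_var w * z + tau_m1 w = tau_m1 w * (1 - y * z)"
    unfolding ma_var_roots by (simp add: algebra_simps power2_eq_square)
  then show "tau_m1 w * z ^ 2 + ma_var w * z + tau_m1 w = 0" using yz by simp
qed (use w_pos u_def z_neg in auto)

abbreviation "\<tau> \<equiv> tau_m1 w"

text \<open>The left boundary condition sees a geometric sequence with ratio \<open>x\<close> through the boundary
  term \<open>coef_at w + \<tau> x\<close>; the quotient of its two values fixes the left solution up to scaling.\<close>

definition \<Theta> :: real where "\<Theta> = (coef_at w + \<tau> * y) / (coef_at w + \<tau> * z)"

abbreviation "r \<equiv> z ^ 2"

lemma z_bound: "0 < coef_at w + \<tau> * z"
  using y_bound mult_strict_left_mono[OF y_less_z Z.tau_pos] by linarith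

lemma Theta_bounds: "0 < \<Theta>" "\<Theta> \<le> 1"
  using y_bound z_bound y_less_z Z.tau_pos by (auto simp: \<Theta>_def divide_simps)

lemma r_bounds: "0 < r" "r < 1"
proof -
  show "0 < r" using z_neg by simp
  have "(- z) * (- z) < (- y) * (- z)" using z_neg y_less_z by (intro mult_strict_right_mono) auto
  then show "r < 1" using yz by (simp add: power2_eq_square)
qed

lemma y_eq: "y = 1 / z" using yz z_neg by (simp add: field_simps)

lemma pow_ratio: "y ^ k * r ^ k = z ^ k"
proof -
  have "y * r = y * z * z" by (simp only: power2_eq_square mult.assoc)
  then show ?thesis unfolding power_mult_distrib[symmetric] using yz by simp
qed

lemma alpha_ratio: "u * z / (u * y) = r"
  using u_pos z_neg unfolding y_eq by (simp add: power2_eq_square)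

text \<open>The ratio of boundary factors in the main terms has the two roots on opposite
  sides compared with \<open>\<Theta>\<close>: by \<open>y z = 1\<close>, \<open>coef_at w * \<alpha>\<^sub>2 + u\<^sup>2 coef_bt w\<close> is
  \<open>\<alpha>\<^sub>2\<close> times the boundary term of \<open>y\<close>.\<close>

lemma boundary_ratio:
  "coef_at w * (u * z) + u ^ 2 * coef_bt w = r * \<Theta> * (coef_at w * (u * y) + u ^ 2 * coef_bt w)"
  "coef_at w * (u * y) + u ^ 2 * coef_bt w \<noteq> 0"
proof -
  have 0: "u ^ 2 * (\<tau> / u) = u * \<tau> * (y * z)"
    using u_pos yz by (simp add: power2_eq_square)
  have 1: "coef_at w * (u * z) + u ^ 2 * coef_bt w = u * z * (coef_at w + \<tau> * y)"
    unfolding coef_bt_tau u_def[symmetric] 0 by (simp add: algebra_simps)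
  have 2: "coef_at w * (u * y) + u ^ 2 * coef_bt w = u * y * (coef_at w + \<tau> * z)"
    unfolding coef_bt_tau u_def[symmetric] 0 by (simp add: algebra_simps)
  have T: "\<Theta> * (coef_at w + \<tau> * z) = coef_at w + \<tau> * y" using z_bound by (simp add: \<Theta>_def)
  have "r * \<Theta> * (u * y * (coef_at w + \<tau> * z)) = (y * z) * (u * z) * (\<Theta> * (coef_at w + \<tau> * z))"
    by (simp only: power2_eq_square mult.assoc mult.commute mult.left_commute)
  then show "coef_at w * (u * z) + u ^ 2 * coef_bt w = r * \<Theta> * (coef_at w * (u * y) + u ^ 2 * coef_bt w)"
    unfolding 1 2 yz T mult_1_left by (rule sym)
  show "coef_at w * (u * y) + u ^ 2 * coef_bt w \<noteq> 0"
    unfolding 2 using u_pos yz z_bound by auto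
qed

text \<open>The left solution. The coefficient \<open>\<Theta> / r\<close> is dictated by the boundary equation
  \<open>phi_boundary\<close>, which results from eliminating the value at 0 from the first two rows.\<close>

definition phi :: "nat \<Rightarrow> real" where
  "phi k = (if k = 0 then - ((1 + w) * u) * (y - \<Theta> / r * z) else y ^ k - \<Theta> / r * z ^ k)"

text \<open>The right solution, vanishing at \<open>n\<close>. Its value at 0 is what row 1 requires.\<close>

definition psi :: "nat \<Rightarrow> nat \<Rightarrow> real" where
  "psi n k = (if k = 0 then - ((y ^ (n - 1) - z ^ (n - 1)) + \<tau> * (y ^ (n - 2) - z ^ (n - 2))) / ((1 + w) * u)
     else y ^ (n - k) - z ^ (n - k))"

definition wronsk :: "nat \<Rightarrow> real" where
  "wronsk n = - \<tau> * (y - z) * y ^ n * (1 - \<Theta> * r ^ (n - 1))"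

lemma coef_at_alt: "coef_at w = 1 - ((1 + w) * u) ^ 2"
  unfolding coef_at_def Let_def u_def by Groebner_Basis.algebra

lemma Theta_div_r: "\<Theta> / r * z = \<Theta> * y"
  unfolding y_eq using z_neg by (simp add: power2_eq_square)

lemma phi_boundary: "coef_at w * phi 1 + \<tau> * phi 2 = 0"
proof -
  define t where "t = \<Theta> / r"
  have "\<Theta> * (coef_at w + \<tau> * z) = coef_at w + \<tau> * y" using z_bound by (simp add: \<Theta>_def)
  then have "t * z * (coef_at w + \<tau> * z) = y * (coef_at w + \<tau> * y)"
    unfolding t_def Theta_div_r by (simp add: mult.commute mult.left_commute)
  moreover have "coef_at w * phi 1 + \<tau> * phi 2 = y * (coef_at w + \<tau> * y) - t * z * (coef_at w + \<tau> * z)"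
    unfolding phi_def t_def[symmetric] by (simp add: algebra_simps power2_eq_square)
  ultimately show ?thesis by simp
qed

lemma one_minus_Theta_pos:
  assumes "2 \<le> n" shows "0 < 1 - \<Theta> * r ^ (n - 1)"
proof -
  have "r ^ (n - 1) < 1" using r_bounds assms by (cases "n - 1") (auto intro!: power_Suc_less_one simp del: power_Suc)
  moreover have "\<Theta> * r ^ (n - 1) \<le> 1 * r ^ (n - 1)"
    using Theta_bounds r_bounds by (intro mult_right_mono) auto
  ultimately show ?thesis by linarith
qed

lemma wronsk_nonzero: "2 \<le> n \<Longrightarrow> wronsk n \<noteq> 0"
  using one_minus_Theta_pos[of n] Z.tau_pos y_less_z z_neg by (auto simp: wronsk_def)

lemma recurrence_pow: "\<tau> * x ^ k + ma_var w * x ^ Suc k + \<tau> * x ^ Suc (Suc k) = 0"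
  if "\<tau> * x ^ 2 + ma_var w * x + \<tau> = 0"
proof -
  have "\<tau> * x ^ k + ma_var w * x ^ Suc k + \<tau> * x ^ Suc (Suc k) = x ^ k * (\<tau> * x ^ 2 + ma_var w * x + \<tau>)"
    by (simp add: algebra_simps power2_eq_square)
  then show ?thesis using that by simp
qed

lemma phi_rec:
  assumes "1 \<le> k"
  shows "\<tau> * phi k + ma_var w * phi (Suc k) + \<tau> * phi (Suc (Suc k)) = 0"
proof -
  define t where "t = \<Theta> / r"
  have "\<tau> * phi k + ma_var w * phi (Suc k) + \<tau> * phi (Suc (Suc k)) =
      (\<tau> * y ^ k + ma_var w * y ^ Suc k + \<tau> * y ^ Suc (Suc k))
      - t * (\<tau> * z ^ k + ma_var w * z ^ Suc k + \<tau> * z ^ Suc (Suc k))"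
    using assms unfolding phi_def t_def[symmetric] by (simp del: power_Suc add: algebra_simps)
  then show ?thesis by (simp only: recurrence_pow[OF Y.root] recurrence_pow[OF Z.root] mult_zero_right diff_0_right)
qed

lemma psi_rec:
  assumes "1 \<le> k" "Suc k < n"
  shows "\<tau> * psi n k + ma_var w * psi n (Suc k) + \<tau> * psi n (Suc (Suc k)) = 0"
proof -
  define m where "m = n - Suc (Suc k)"
  have m: "n - k = Suc (Suc m)" "n - Suc k = Suc m" using assms by (auto simp: m_def)
  have "\<tau> * psi n k + ma_var w * psi n (Suc k) + \<tau> * psi n (Suc (Suc k)) =
      (\<tau> * y ^ m + ma_var w * y ^ Suc m + \<tau> * y ^ Suc (Suc m))
      - (\<tau> * z ^ m + ma_var w * z ^ Suc m + \<tau> * z ^ Suc (Suc m))"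
    using assms unfolding psi_def m m_def[symmetric] by (simp del: power_Suc add: algebra_simps)
  then show ?thesis by (simp only: recurrence_pow[OF Y.root] recurrence_pow[OF Z.root] mult_zero_right diff_0_right)
qed

text \<open>The mixed products of powers of \<open>y\<close> and \<open>z\<close> cancel because \<open>y z = 1\<close>.\<close>

lemma phi_psi_wronskian:
  assumes "1 \<le> k" "k < n"
  shows "\<tau> * (phi k * psi n (Suc k) - phi (Suc k) * psi n k) = wronsk n"
proof -
  define m where "m = n - Suc k"
  have e: "n - k = Suc m" "n = Suc (k + m)" "n - 1 = k + m" using assms by (auto simp: m_def)
  define t where "t = \<Theta> / r"
  have "(y ^ k - t * z ^ k) * (y ^ m - z ^ m) - (y ^ Suc k - t * z ^ Suc k) * (y ^ Suc m - z ^ Suc m)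
      = y ^ (k + m) * (1 - y * y) + t * z ^ (k + m) * (1 - z * z)
        - (1 - y * z) * (y ^ k * z ^ m + t * (y ^ m * z ^ k))"
    by (simp add: algebra_simps power_add)
  also have "\<dots> = y ^ (k + m) * (1 - y * y) + t * z ^ (k + m) * (1 - z * z)"
    using yz by simp
  also have "\<dots> = y ^ (k + m) * ((1 - y * y) + r ^ (k + m) * (t * (1 - z * z)))"
  proof -
    have zy: "z ^ (k + m) = y ^ (k + m) * r ^ (k + m)" by (simp only: pow_ratio)
    show ?thesis unfolding zy by (simp only: algebra_simps)
  qed
  also have "1 - y * y = - (y - z) * y" using yz by (simp add: algebra_simps)
  also have "t * (1 - z * z) = \<Theta> * ((y - z) * y)"
  proof -
    have "r * ((y - z) * y) = (y * z) * (y * z) - z * z * (y * z)"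
      by (simp add: algebra_simps power2_eq_square)
    then have "1 - z * z = r * ((y - z) * y)" using yz by simp
    then show ?thesis using r_bounds by (simp add: t_def)
  qed
  also have "y ^ (k + m) * (- (y - z) * y + r ^ (k + m) * (\<Theta> * ((y - z) * y))) = - (y - z) * y ^ n * (1 - \<Theta> * r ^ (n - 1))"
    unfolding e(3) unfolding e(2) by (simp add: algebra_simps)
  finally have *: "(y ^ k - t * z ^ k) * (y ^ m - z ^ m) - (y ^ Suc k - t * z ^ Suc k) * (y ^ Suc m - z ^ Suc m)
      = - (y - z) * y ^ n * (1 - \<Theta> * r ^ (n - 1))" .
  have "phi k * psi n (Suc k) - phi (Suc k) * psi n k = - (y - z) * y ^ n * (1 - \<Theta> * r ^ (n - 1))"
    using * assms unfolding phi_def psi_def m_def[symmetric] e(1) t_def[symmetric] by simp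
  then show ?thesis unfolding wronsk_def by (simp only: mult_minus_left mult_minus_right mult.assoc)
qed

lemma Rinv_entries:
  assumes "4 \<le> n" "\<theta> / real n = w"
  shows "invertible_mat (Rmat \<theta> n)"
    and "the (mat_inverse (Rmat \<theta> n)) =
      transpose_mat (whitening_mat n u) * green_mat n phi (psi n) (wronsk n) * whitening_mat n u"
proof -
  let ?T = "whitening_mat n u" and ?G = "green_mat n phi (psi n) (wronsk n)"
  define d where "d = (\<lambda>k::nat. if k < 2 then 1 else ma_var w)"
  define e where "e = (\<lambda>k::nat. if k = 0 then (1 + w) * u else \<tau>)"
  have M: "?T * Rmat \<theta> n * transpose_mat ?T = tridiag_mat n d e"
    unfolding Rmat_matern_cov assms(2) d_def e_def u_def by (rule whitened_cov)
  have wu: "(1 + w) * u \<noteq> 0" using w_pos u_pos by simp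
  have phi0: "phi 0 = - ((1 + w) * u) * phi 1" by (simp add: phi_def)
  have psi0: "(1 + w) * u * psi n 0 + psi n 1 + \<tau> * psi n 2 = 0"
    using wu w_pos u_pos assms by (simp add: psi_def numeral_2_eq_2)
  have MG: "tridiag_mat n d e * ?G = 1\<^sub>m n"
  proof (rule tridiag_green_inverse)
    show "d 0 * phi 0 + e 0 * phi 1 = 0" by (simp add: d_def e_def phi0)
    show "psi n n = 0" using assms by (simp add: psi_def)
    show "wronsk n \<noteq> 0" using wronsk_nonzero assms by simp
  next
    fix k assume k: "1 \<le> k" "k < n"
    show "e (k - 1) * phi (k - 1) + d k * phi k + e k * phi (Suc k) = 0"
    proof (cases "k = 1")
      case True
      have "e 0 * phi 0 + d 1 * phi 1 + e 1 * phi 2 = coef_at w * phi 1 + \<tau> * phi 2"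
        by (simp add: d_def e_def phi0 coef_at_alt power2_eq_square algebra_simps)
      then show ?thesis using True phi_boundary by (simp add: numeral_2_eq_2)
    next
      case False
      then show ?thesis using phi_rec[of "k - 1"] k by (simp add: d_def e_def)
    qed
    show "e (k - 1) * psi n (k - 1) + d k * psi n k + e k * psi n (Suc k) = 0"
    proof (cases "k = 1")
      case True
      then show ?thesis using psi0 by (simp add: d_def e_def numeral_2_eq_2)
    next
      case False
      then show ?thesis using psi_rec[of "k - 1" n] k by (simp add: d_def e_def)
    qed
  next
    fix k assume k: "k < n"
    show "e k * (phi k * psi n (Suc k) - phi (Suc k) * psi n k) = wronsk n"
    proof (cases "k = 0")
      case True
      define c where "c = (1 + w) * u"
      have c: "c * psi n 0 = - (psi n 1 + \<tau> * psi n 2)" "phi 0 = - c * phi 1" "coef_at w = 1 - c ^ 2"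
        using psi0 phi0 coef_at_alt by (auto simp: c_def)
      have "c * (phi 0 * psi n 1 - phi 1 * psi n 0) = c * phi 0 * psi n 1 - phi 1 * (c * psi n 0)"
        by (simp add: algebra_simps)
      also have "\<dots> = psi n 1 * (coef_at w * phi 1 + \<tau> * phi 2) + \<tau> * (phi 1 * psi n 2 - phi 2 * psi n 1)"
        unfolding c by (simp add: algebra_simps power2_eq_square)
      also have "\<dots> = \<tau> * (phi 1 * psi n 2 - phi 2 * psi n 1)" by (simp add: phi_boundary[simplified])
      also have "\<dots> = wronsk n" using phi_psi_wronskian[of 1 n] assms by (simp add: numeral_2_eq_2)
      finally show ?thesis using True by (simp add: e_def c_def)
    next
      case False
      then show ?thesis using phi_psi_wronskian[of k n] k by (simp add: e_def)
    qed
  qed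
  have car: "Rmat \<theta> n \<in> carrier_mat n n" "?T \<in> carrier_mat n n" "?G \<in> carrier_mat n n"
    by (auto simp: Rmat_def whitening_mat_def green_mat_def)
  from congruence_inverse[OF car M MG]
  show "invertible_mat (Rmat \<theta> n)"
    and "the (mat_inverse (Rmat \<theta> n)) = transpose_mat ?T * ?G * ?T" by auto
qed

text \<open>Entry \<open>(i, j)\<close> of \<open>T\<^sup>T G T\<close>, for \<open>i\<close> at distance at least two from the lower end, is the
  look-ahead filter applied in both indices.\<close>

lemma Rinv_filtered:
  assumes "4 \<le> n" "\<theta> / real n = w" "2 \<le> i" "i + 2 < n" "2 \<le> j" "j < n"
  defines "G \<equiv> \<lambda>p q. phi (min p q) * psi n (max p q) / wronsk n"
  defines "H \<equiv> \<lambda>p. G p j + (if j + 1 < n then - 2 * u * G p (j + 1) else 0) + (if j + 2 < n then u ^ 2 * G p (j + 2) else 0)"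
  shows "Rinv \<theta> n (i + 1) (j + 1) = H i - 2 * u * H (i + 1) + u ^ 2 * H (i + 2)"
proof -
  let ?T = "whitening_mat n u" and ?G = "green_mat n phi (psi n) (wronsk n)"
  have T: "?T \<in> carrier_mat n n" and G: "?G \<in> carrier_mat n n" by (auto simp: whitening_mat_def green_mat_def)
  have "Rinv \<theta> n (i + 1) (j + 1) = (transpose_mat ?T * ?G * ?T) $$ (i, j)"
    by (simp add: Rinv_def Rinv_entries(2)[OF assms(1,2)])
  also have "\<dots> = (\<Sum>k<n. transpose_mat ?T $$ (i, k) * (\<Sum>l<n. ?T $$ (l, j) * ?G $$ (k, l)))"
    using T G assms by (intro sandwich_entry) auto
  also have "\<dots> = (\<Sum>k<n. ?T $$ (k, i) * (\<Sum>l<n. ?T $$ (l, j) * G k l))"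
    using T assms by (intro sum.cong refl arg_cong2[of _ _ _ _ "(*)"]) (auto simp: green_mat_def G_def)
  also have "\<dots> = (\<Sum>k<n. ?T $$ (k, i) * H k)"
  proof -
    have "(\<Sum>l<n. ?T $$ (l, j) * G k l) = H k" for k
      unfolding H_def using assms(5,6) by (intro whitening_col_sum) auto
    then show ?thesis by simp
  qed
  also have "\<dots> = H i - 2 * u * H (i + 1) + u ^ 2 * H (i + 2)"
    using whitening_col_sum[of i n u H] assms(3,4) by simp
  finally show ?thesis .
qed

text \<open>Away from the boundary, the filter multiplies the two geometric parts of
  \<open>\<phi>\<close> and \<open>\<psi>\<close> by the squares of \<open>1 - u y\<close> and \<open>1 - u z\<close>.\<close>

lemma phi_filtered:
  assumes "1 \<le> i"
  shows "phi i - 2 * u * phi (i + 1) + u ^ 2 * phi (i + 2) = y ^ i * ((1 - u * y) ^ 2 - \<Theta> * r ^ (i - 1) * (1 - u * z) ^ 2)"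
proof -
  have zi: "z ^ i = y ^ i * r ^ i" by (simp only: pow_ratio)
  define t where "t = \<Theta> / r"
  have "phi i - 2 * u * phi (i + 1) + u ^ 2 * phi (i + 2) = y ^ i * (1 - u * y) ^ 2 - t * z ^ i * (1 - u * z) ^ 2"
    using assms unfolding phi_def t_def[symmetric] by (simp add: algebra_simps power2_eq_square)
  also have "\<dots> = y ^ i * ((1 - u * y) ^ 2 - t * r ^ i * (1 - u * z) ^ 2)"
    unfolding zi by (simp only: right_diff_distrib mult.assoc mult.commute mult.left_commute)
  also have "t * r ^ i = \<Theta> * r ^ (i - 1)"
    using assms z_neg by (simp add: t_def power_eq_if)
  finally show ?thesis .
qed

lemma psi_filtered:
  assumes "1 \<le> j" "j + 2 \<le> n"
  shows "psi n j - 2 * u * psi n (j + 1) + u ^ 2 * psi n (j + 2)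
    = y ^ (n - j) * ((1 - u * z) ^ 2 - r ^ (n - j) * (1 - u * y) ^ 2)"
proof -
  define m where "m = n - (j + 2)"
  have m: "n - j = Suc (Suc m)" "n - (j + 1) = Suc m" using assms by (auto simp: m_def)
  have "y ^ (n - j) * ((1 - u * z) ^ 2 - r ^ (n - j) * (1 - u * y) ^ 2)
      = y ^ (n - j) * (1 - u * z) ^ 2 - (y ^ (n - j) * r ^ (n - j)) * (1 - u * y) ^ 2"
    by (simp only: right_diff_distrib mult.assoc)
  also have "\<dots> = y ^ m * (y * (1 - u * z)) ^ 2 - z ^ m * (z * (1 - u * y)) ^ 2"
    unfolding pow_ratio m(1) by (simp add: power2_eq_square algebra_simps)
  also have "y * (1 - u * z) = y - u * (y * z)" by (simp add: algebra_simps)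
  also have "z * (1 - u * y) = z - u * (y * z)" by (simp add: algebra_simps)
  also have "y ^ m * (y - u * (y * z)) ^ 2 - z ^ m * (z - u * (y * z)) ^ 2
      = psi n j - 2 * u * psi n (j + 1) + u ^ 2 * psi n (j + 2)"
    using assms unfolding yz psi_def m m_def[symmetric] by (simp add: power2_eq_square algebra_simps)
  finally show ?thesis by simp
qed

text \<open>The factors by which the look-ahead filter multiplies the geometric sequences with ratios
  \<open>y\<close> and \<open>z\<close>.\<close>

abbreviation (input) "P \<equiv> (1 - u * y) ^ 2"
abbreviation (input) "Q \<equiv> (1 - u * z) ^ 2"

text \<open>Multiplication by \<open>1 - \<Theta> r\<^sup>n\<^sup>-\<^sup>1\<close> cancels that factor of the Wronskian, and the power of
  \<open>y\<close> left in the denominator turns the remaining powers of \<open>y\<close> into a power of \<open>z = 1 / y\<close>.\<close>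

lemma product_entry:
  assumes "2 \<le> n" "i \<le> j" "j \<le> n"
  shows "(y ^ i * A) * (y ^ (n - j) * B) / wronsk n * (1 - \<Theta> * r ^ (n - 1)) = - (z ^ (j - i) * A * B) / (\<tau> * (y - z))"
proof -
  have nz: "y \<noteq> 0" "\<tau> \<noteq> 0" "y - z \<noteq> 0" using yz Z.tau_pos y_less_z by auto
  have yn: "y ^ n = y ^ i * y ^ (j - i) * y ^ (n - j)" using assms by (simp flip: power_add)
  have zy: "y ^ (j - i) * z ^ (j - i) = 1" using yz by (simp flip: power_mult_distrib)
  have W: "wronsk n = - (\<tau> * (y - z) * y ^ n) * (1 - \<Theta> * r ^ (n - 1))" by (simp add: wronsk_def)
  have "(y ^ i * A) * (y ^ (n - j) * B) / wronsk n * (1 - \<Theta> * r ^ (n - 1))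
      = - ((y ^ i * A) * (y ^ (n - j) * B)) / (\<tau> * (y - z) * y ^ n)"
    unfolding W using one_minus_Theta_pos[OF assms(1)] by simp
  also have "\<dots> = - ((y ^ i * A) * (y ^ (n - j) * B) * (y ^ (j - i) * z ^ (j - i))) / (\<tau> * (y - z) * y ^ n)"
    unfolding zy by simp
  also have "\<dots> = - (z ^ (j - i) * A * B * y ^ n) / (\<tau> * (y - z) * y ^ n)"
    unfolding yn by (simp only: mult.assoc mult.commute mult.left_commute)
  also have "\<dots> = - (z ^ (j - i) * A * B) / (\<tau> * (y - z))" using nz by simp
  finally show ?thesis .
qed

text \<open>In the last column there is nothing to look ahead to, so only the left solution is
  filtered.\<close>

lemma entry_last:
  assumes "4 \<le> n" "\<theta> / real n = w" "2 \<le> i" "i + 2 < n"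
  shows "Rinv \<theta> n (i + 1) n * (1 - \<Theta> * r ^ (n - 1)) =
    - (z ^ (n - i)) * (P - \<Theta> * r ^ (i - 1) * Q) / \<tau>"
proof -
  let ?G = "\<lambda>p q. phi (min p q) * psi n (max p q) / wronsk n"
  have psi: "psi n (n - 1) = y - z" using assms by (simp add: psi_def)
  have "Rinv \<theta> n (i + 1) (n - 1 + 1) = ?G i (n - 1) - 2 * u * ?G (i + 1) (n - 1) + u ^ 2 * ?G (i + 2) (n - 1)"
    using Rinv_filtered[OF assms(1-4), of "n - 1"] assms by simp
  also have "\<dots> = phi i * (psi n (n - 1) / wronsk n) - 2 * u * (phi (i + 1) * (psi n (n - 1) / wronsk n))
      + u ^ 2 * (phi (i + 2) * (psi n (n - 1) / wronsk n))"
    using assms by (simp add: min_absorb1 max_absorb2 le_diff_conv2)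
  also have "\<dots> = (phi i - 2 * u * phi (i + 1) + u ^ 2 * phi (i + 2)) * (psi n (n - 1) / wronsk n)"
    by (simp only: algebra_simps)
  also have "\<dots> = (y ^ i * (P - \<Theta> * r ^ (i - 1) * Q)) * (y ^ (n - n) * (y - z)) / wronsk n"
    using phi_filtered[of i] assms by (simp add: psi[simplified])
  finally have e: "Rinv \<theta> n (i + 1) n = (y ^ i * (P - \<Theta> * r ^ (i - 1) * Q)) * (y ^ (n - n) * (y - z)) / wronsk n"
    using assms by simp
  have "y - z \<noteq> 0" using y_less_z by simp
  then show ?thesis unfolding e using assms by (subst product_entry) auto
qed

text \<open>For \<open>j \<ge> i + 2\<close>, all nine pairs of indices occurring in the filter lie on or above the
  diagonal, so the double filter factors into one acting on \<open>\<phi>\<close> and one acting on \<open>\<psi>\<close>. For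
  \<open>j = n - 2\<close>, where column \<open>j + 2\<close> does not exist, the product still holds because \<open>\<psi>\<close> vanishes
  at \<open>n\<close>.\<close>

lemma entry_far:
  assumes "4 \<le> n" "\<theta> / real n = w" "2 \<le> i" "i + 2 \<le> j" "j + 2 \<le> n"
  shows "Rinv \<theta> n (i + 1) (j + 1) * (1 - \<Theta> * r ^ (n - 1)) =
    - (z ^ (j - i) * (P - \<Theta> * r ^ (i - 1) * Q) * (Q - r ^ (n - j) * P)) / (\<tau> * (y - z))"
proof -
  define G where "G p q = phi (min p q) * psi n (max p q) / wronsk n" for p q
  define H where "H p = G p j + (if j + 1 < n then - 2 * u * G p (j + 1) else 0) + (if j + 2 < n then u ^ 2 * G p (j + 2) else 0)" for p
  have G_n: "G p n = 0" if "p \<le> n" for p using that assms by (simp add: G_def psi_def)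
  have H: "H p = phi p * ((psi n j - 2 * u * psi n (j + 1) + u ^ 2 * psi n (j + 2)) / wronsk n)" if "p \<le> j" for p
  proof -
    have "H p = G p j - 2 * u * G p (j + 1) + u ^ 2 * G p (j + 2)"
      using assms G_n[of p] that by (cases "j + 2 = n") (auto simp: H_def)
    also have "\<dots> = phi p * ((psi n j - 2 * u * psi n (j + 1) + u ^ 2 * psi n (j + 2)) / wronsk n)"
      using that by (simp add: G_def add_divide_distrib diff_divide_distrib algebra_simps)
    finally show ?thesis .
  qed
  have "Rinv \<theta> n (i + 1) (j + 1) = H i - 2 * u * H (i + 1) + u ^ 2 * H (i + 2)"
    unfolding H_def G_def using assms by (intro Rinv_filtered) auto
  also have "\<dots> = (phi i - 2 * u * phi (i + 1) + u ^ 2 * phi (i + 2)) *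
      ((psi n j - 2 * u * psi n (j + 1) + u ^ 2 * psi n (j + 2)) / wronsk n)"
    using assms by (simp only: H algebra_simps add_leD1)
  also have "\<dots> = (y ^ i * (P - \<Theta> * r ^ (i - 1) * Q)) * (y ^ (n - j) * (Q - r ^ (n - j) * P)) / wronsk n"
    using phi_filtered[of i] psi_filtered[of j n] assms by simp
  finally show ?thesis using assms product_entry[of n i j] by simp
qed

lemma wronskian_div:
  assumes "1 \<le> k" "k < n"
  shows "(phi k * psi n (Suc k) - phi (Suc k) * psi n k) / wronsk n = 1 / \<tau>"
proof -
  have t: "\<tau> \<noteq> 0" using Z.tau_pos by simp
  have "wronsk n \<noteq> 0" using assms by (intro wronsk_nonzero) auto
  then show ?thesis using phi_psi_wronskian[OF assms] t by (simp add: field_simps)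
qed

text \<open>One more step of the recurrence multiplies the Wronskian by \<open>- \<gamma> / \<tau> = y + z\<close>.\<close>

lemma wronskian_div_2:
  assumes "1 \<le> k" "Suc k < n"
  shows "(phi k * psi n (Suc (Suc k)) - phi (Suc (Suc k)) * psi n k) / wronsk n = (y + z) / \<tau>"
proof -
  have t: "\<tau> \<noteq> 0" using Z.tau_pos by simp
  have "\<tau> * (phi k * psi n (Suc (Suc k)) - phi (Suc (Suc k)) * psi n k)
      = phi k * (\<tau> * psi n k + ma_var w * psi n (Suc k) + \<tau> * psi n (Suc (Suc k)))
        - psi n k * (\<tau> * phi k + ma_var w * phi (Suc k) + \<tau> * phi (Suc (Suc k)))
        - ma_var w * (phi k * psi n (Suc k) - phi (Suc k) * psi n k)"
    by (simp only: algebra_simps)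
  also have "\<dots> = \<tau> * ((y + z) * (phi k * psi n (Suc k) - phi (Suc k) * psi n k))"
    unfolding phi_rec[OF assms(1)] psi_rec[OF assms] unfolding ma_var_roots by (simp add: algebra_simps)
  finally have *: "phi k * psi n (Suc (Suc k)) - phi (Suc (Suc k)) * psi n k
      = (y + z) * (phi k * psi n (Suc k) - phi (Suc k) * psi n k)" using t by simp
  show ?thesis unfolding * times_divide_eq_right[symmetric] using wronskian_div[of k n] assms by simp
qed

text \<open>Exactly one index pair, \<open>(i + 2, i + 1)\<close>, lies below the diagonal. There the roles of \<open>\<phi>\<close> and
  \<open>\<psi>\<close> are exchanged with respect to the product formula, which costs one Wronskian.\<close>

lemma entry_superdiag:
  assumes "4 \<le> n" "\<theta> / real n = w" "2 \<le> i" "i + 2 < n"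
  shows "Rinv \<theta> n (i + 1) (i + 2) * (1 - \<Theta> * r ^ (n - 1)) =
    - (z * (P - \<Theta> * r ^ (i - 1) * Q) * (Q - r ^ (n - i - 1) * P)) / (\<tau> * (y - z))
    + u ^ 2 / \<tau> * (1 - \<Theta> * r ^ (n - 1))"
proof -
  define j where "j = Suc i"
  define G where "G p q = phi (min p q) * psi n (max p q) / wronsk n" for p q
  define H where "H p = G p j + (if j + 1 < n then - 2 * u * G p (j + 1) else 0) + (if j + 2 < n then u ^ 2 * G p (j + 2) else 0)" for p
  have G_n: "G p n = 0" if "p \<le> n" for p using that assms by (simp add: G_def psi_def)
  have H: "H p = G p j - 2 * u * G p (j + 1) + u ^ 2 * G p (j + 2)" if "p \<le> n" for p
    using assms G_n[of p] that by (cases "j + 2 = n") (auto simp: H_def j_def)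
  have "Rinv \<theta> n (i + 1) (j + 1) = H i - 2 * u * H (i + 1) + u ^ 2 * H (i + 2)"
    unfolding H_def G_def using assms by (intro Rinv_filtered) (auto simp: j_def)
  also have "\<dots> = (phi i - 2 * u * phi (i + 1) + u ^ 2 * phi (i + 2)) *
      (psi n j - 2 * u * psi n (j + 1) + u ^ 2 * psi n (j + 2)) / wronsk n
      + u ^ 2 * ((phi j * psi n (Suc j) - phi (Suc j) * psi n j) / wronsk n)"
    using assms by (simp add: H G_def j_def add_divide_distrib diff_divide_distrib algebra_simps)
  also have "\<dots> = (y ^ i * (P - \<Theta> * r ^ (i - 1) * Q)) * (y ^ (n - j) * (Q - r ^ (n - j) * P)) / wronsk n
      + u ^ 2 * (1 / \<tau>)"
    using phi_filtered[of i] psi_filtered[of j n] wronskian_div[of j n] assms by (simp add: j_def)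
  finally have e: "Rinv \<theta> n (i + 1) (j + 1) = \<dots>" .
  have "Rinv \<theta> n (i + 1) (j + 1) * (1 - \<Theta> * r ^ (n - 1)) =
    (y ^ i * (P - \<Theta> * r ^ (i - 1) * Q)) * (y ^ (n - j) * (Q - r ^ (n - j) * P)) / wronsk n * (1 - \<Theta> * r ^ (n - 1))
    + u ^ 2 / \<tau> * (1 - \<Theta> * r ^ (n - 1))"
    unfolding e by (simp only: distrib_right) simp
  then show ?thesis using product_entry[of n i j] assms by (simp add: j_def)
qed

text \<open>Three index pairs lie below the diagonal, two at distance one and one at distance two; each
  contributes a multiple of the Wronskian as a correction to the product formula.\<close>

lemma entry_diag:
  assumes "4 \<le> n" "\<theta> / real n = w" "2 \<le> i" "i + 2 < n"
  shows "Rinv \<theta> n (i + 1) (i + 1) * (1 - \<Theta> * r ^ (n - 1)) =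
    - ((P - \<Theta> * r ^ (i - 1) * Q) * (Q - r ^ (n - i) * P)) / (\<tau> * (y - z))
    + (u ^ 2 * (y + z) - 2 * u - 2 * u ^ 3) / \<tau> * (1 - \<Theta> * r ^ (n - 1))"
proof -
  define G where "G p q = phi (min p q) * psi n (max p q) / wronsk n" for p q
  define H where "H p = G p i + (if i + 1 < n then - 2 * u * G p (i + 1) else 0) + (if i + 2 < n then u ^ 2 * G p (i + 2) else 0)" for p
  have H: "H p = G p i - 2 * u * G p (i + 1) + u ^ 2 * G p (i + 2)" for p
    using assms by (simp add: H_def)
  have "Rinv \<theta> n (i + 1) (i + 1) = H i - 2 * u * H (i + 1) + u ^ 2 * H (i + 2)"
    unfolding H_def G_def using assms by (intro Rinv_filtered) auto
  also have "\<dots> = (phi i - 2 * u * phi (i + 1) + u ^ 2 * phi (i + 2)) *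
      (psi n i - 2 * u * psi n (i + 1) + u ^ 2 * psi n (i + 2)) / wronsk n
      - 2 * u * ((phi i * psi n (Suc i) - phi (Suc i) * psi n i) / wronsk n)
      + u ^ 2 * ((phi i * psi n (Suc (Suc i)) - phi (Suc (Suc i)) * psi n i) / wronsk n)
      - 2 * u ^ 3 * ((phi (Suc i) * psi n (Suc (Suc i)) - phi (Suc (Suc i)) * psi n (Suc i)) / wronsk n)"
    using assms by (simp add: H G_def add_divide_distrib diff_divide_distrib algebra_simps power3_eq_cube power2_eq_square)
  also have "\<dots> = (y ^ i * (P - \<Theta> * r ^ (i - 1) * Q)) * (y ^ (n - i) * (Q - r ^ (n - i) * P)) / wronsk n
      - 2 * u * (1 / \<tau>) + u ^ 2 * ((y + z) / \<tau>) - 2 * u ^ 3 * (1 / \<tau>)"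
    using phi_filtered[of i] psi_filtered[of i n] wronskian_div[of i n] wronskian_div[of "Suc i" n]
      wronskian_div_2[of i n] assms by simp
  also have "\<dots> = (y ^ i * (P - \<Theta> * r ^ (i - 1) * Q)) * (y ^ (n - i) * (Q - r ^ (n - i) * P)) / wronsk n
      + (u ^ 2 * (y + z) - 2 * u - 2 * u ^ 3) / \<tau>"
    by (simp add: add_divide_distrib diff_divide_distrib distrib_left)
  finally have e: "Rinv \<theta> n (i + 1) (i + 1) = \<dots>" .
  have "Rinv \<theta> n (i + 1) (i + 1) * (1 - \<Theta> * r ^ (n - 1)) =
    (y ^ i * (P - \<Theta> * r ^ (i - 1) * Q)) * (y ^ (n - i) * (Q - r ^ (n - i) * P)) / wronsk n * (1 - \<Theta> * r ^ (n - 1))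
    + (u ^ 2 * (y + z) - 2 * u - 2 * u ^ 3) / \<tau> * (1 - \<Theta> * r ^ (n - 1))"
    unfolding e by (simp only: distrib_right)
  then show ?thesis using product_entry[of n i i] assms by simp
qed

section \<open>Matching the entries with the closed formulas\<close>

lemma C6_y: "C6 w (u * y) = \<tau> ^ 2 * P" and C6_z: "C6 w (u * z) = \<tau> ^ 2 * Q"
  by (rule Y.C6_root Z.C6_root)+

text \<open>Both coefficients are combinations of \<open>\<tau>\<close> and \<open>\<gamma>\<close>, and \<open>\<gamma>\<close> is expressed by the sum of the
  roots; what remains is a perfect square.\<close>

lemma ab_root: assumes "x * x' = 1" "x + x' = y + z"
  shows "coef_a w * (u * x) + u ^ 2 * coef_b w = - u * \<tau> * (x - u) ^ 2"
proof -
  have b: "coef_b w = \<tau> / u - \<tau> * u" using coef_b_tau[of w] by (simp add: u_def)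
  have a: "coef_a w = - \<tau> * (x + x') + 2 * \<tau> * u"
    using coef_a_ma_var[of w] ma_var_roots assms by (simp add: u_def)
  have "u ^ 2 * (\<tau> / u) = u * \<tau> * (x * x')" using u_pos assms by (simp add: power2_eq_square)
  then show ?thesis unfolding a b by (simp add: algebra_simps power2_eq_square)
qed

text \<open>The factor \<open>a \<alpha> + u\<^sup>2 b\<close> supplies \<open>(y - u)\<^sup>2\<close>, which is \<open>(1 - u z)\<^sup>2\<close> up to a power of
  \<open>y\<close>, and \<^const>\<open>C6\<close> supplies the other filter factor.\<close>

lemma main_offdiag_entry:
  assumes "2 \<le> i" "i + 2 \<le> j" "j + 2 \<le> n"
  shows "main_offdiag w n (i + 1) (j + 1) =
    - (z ^ (j - i) * (P - \<Theta> * r ^ (i - 1) * Q) * (Q - r ^ (n - j) * P)) / (\<tau> * (y - z))"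
proof -
  obtain m where m: "n = j + 2 + m" using assms(3) le_Suc_ex by blast
  obtain l where l: "i = 2 + l" using assms(1) le_Suc_ex by blast
  obtain d where d: "j = i + d" using assms(2) le_Suc_ex[of i j] by auto
  have e: "j + 1 - (i + 1) + 2 = d + 2" "n - (j + 1) - 1 = m" "i + 1 - 3 = l" "n - (j + 1) + (i + 1) - 4 = l + m"
    "j - i = d" "i - 1 = l + 1" "n - j = m + 2"
    using assms by (auto simp: m l d)
  define N where "N = coef_at w * (u * y) + u ^ 2 * coef_bt w"
  have N: "N \<noteq> 0" "coef_at w * (u * z) + u ^ 2 * coef_bt w = r * \<Theta> * N"
    using boundary_ratio by (auto simp: N_def)
  define s where "s = (y - u) ^ 2 - (z - u) ^ 2 * r ^ m"
  have nz: "u \<noteq> 0" "y \<noteq> 0" "\<tau> \<noteq> 0" "y - z \<noteq> 0" using yz Z.tau_pos y_less_z u_pos by auto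
  have zy: "z * y = 1" using yz by (simp add: mult.commute)
  have uy: "u / (u * y) = z" using nz zy by (simp add: field_simps)
  have br1: "- u * \<tau> * (y - u) ^ 2 - - u * \<tau> * (z - u) ^ 2 * r ^ m = - u * \<tau> * s"
    by (simp add: s_def algebra_simps)
  have br2: "- u * \<tau> * (y - u) ^ 2 * r ^ l - - u * \<tau> * (z - u) ^ 2 * r ^ (l + m) = - u * \<tau> * s * r ^ l"
    by (simp add: s_def algebra_simps power_add)
  have Q: "Q - r ^ (m + 2) * P = z ^ 2 * s"
  proof -
    have 1: "Q = z ^ 2 * (y - u) ^ 2"
    proof -
      have "z ^ 2 * (y - u) ^ 2 = (z * y - u * z) ^ 2" by (simp add: power2_eq_square algebra_simps)
      then show ?thesis unfolding zy by simp
    qed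
    have 2: "r * P = (z - u) ^ 2"
    proof -
      have "r * P = (z - u * (z * y)) ^ 2" by (simp add: power2_eq_square algebra_simps)
      then show ?thesis unfolding zy by simp
    qed
    have "r ^ (m + 2) * P = r ^ m * r * (r * P)"
      by (simp only: power_add power2_eq_square[of "z ^ 2"] mult.assoc)
    then have 3: "r ^ (m + 2) * P = r ^ m * r * (z - u) ^ 2" unfolding 2 .
    show ?thesis unfolding 3 1 s_def by (simp only: right_diff_distrib mult.commute mult.left_commute)
  qed
  have "main_offdiag w n (i + 1) (j + 1) =
     1 / (\<tau> ^ 4 * (u * y - u * z)) * z ^ (d + 2)
     * (\<tau> ^ 2 * P * (- u * \<tau> * s) - \<tau> ^ 2 * Q * (r * \<Theta> * N) / N * (- u * \<tau> * s * r ^ l))"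
    unfolding main_offdiag_def Let_def u_def[symmetric] alpha1_eq alpha2_eq alpha_ratio e uy C6_y C6_z
      ab_root[OF yz refl] ab_root[OF zy add.commute] N_def[symmetric] N(2) br1 br2 ..
  also have "\<dots> = - (z ^ d * (P - \<Theta> * r ^ (l + 1) * Q) * (z ^ 2 * s)) / (\<tau> * (y - z))"
  proof -
    have "u * y - u * z = u * (y - z)" by (simp add: algebra_simps)
    moreover define q where "q = y - z"
    ultimately show ?thesis using N(1) nz by (simp add: field_simps eval_nat_numeral)
  qed
  finally show ?thesis unfolding e Q .
qed

lemma cube_roots:
  "- (coef_b w + \<tau> * u) * (u * x) = - (\<tau> * x)"
  using coef_b_tau[of w] u_pos by (simp add: u_def)

lemma main_lastcol_entry:
  assumes "2 \<le> i" "i + 2 < n"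
  shows "main_lastcol w n (i + 1) = - (z ^ (n - i)) * (P - \<Theta> * r ^ (i - 1) * Q) / \<tau>"
proof -
  obtain m where m: "n = i + 3 + m" using assms(2) less_imp_Suc_add[of "i + 2" n] by auto
  obtain l where l: "i = 2 + l" using assms(1) le_Suc_ex by blast
  have e: "n - (i + 1) - 2 = m" "n - (l + 3) - 2 = m" "i - 1 = l + 1" "n - i = m + 3" "i + 1 = l + 3"
    using assms by (auto simp: m l)
  define N where "N = coef_at w * (u * y) + u ^ 2 * coef_bt w"
  have N: "N \<noteq> 0" "coef_at w * (u * z) + u ^ 2 * coef_bt w = r * \<Theta> * N"
    using boundary_ratio by (auto simp: N_def)
  have nz: "u \<noteq> 0" "\<tau> \<noteq> 0" "z \<noteq> 0" using Z.tau_pos u_pos z_neg by auto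
  have uy: "u / (u * y) = z" unfolding y_eq using nz by simp
  have "main_lastcol w n (i + 1) = \<tau> ^ 2 * P / (- (\<tau> * y)) ^ 3 * z ^ m
     - \<tau> ^ 2 * Q * (r * \<Theta> * N) / (N * (- (\<tau> * z)) ^ 3) * z ^ m * r ^ (l + 3)"
    unfolding main_lastcol_def Let_def u_def[symmetric] alpha1_eq alpha2_eq alpha_ratio e uy C6_y C6_z cube_roots
      N_def[symmetric] N(2) ..
  also have "\<dots> = - (z ^ (m + 3)) * (P - \<Theta> * r ^ (l + 1) * Q) / \<tau>"
  proof -
    have 1: "\<tau> ^ 2 * p / (- (\<tau> * y)) ^ 3 * z ^ m = - (z ^ (m + 3)) * p / \<tau>" for p
      unfolding y_eq using nz by (simp add: field_simps eval_nat_numeral)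
    have 2: "\<tau> ^ 2 * q * (r * \<Theta> * N) / (N * (- (\<tau> * z)) ^ 3) * z ^ m * r ^ (l + 3)
        = - (z ^ (m + 3)) * \<Theta> * r ^ (l + 1) * q / \<tau>" for q
      using nz N(1) by (simp add: field_simps power_add eval_nat_numeral)
    show ?thesis unfolding 1 2 by (simp add: right_diff_distrib diff_divide_distrib mult.assoc)
  qed
  finally show ?thesis unfolding e .
qed

text \<open>Grouping the four terms of \<^const>\<open>band_main\<close> by powers of \<open>r\<close> leaves the coefficients
  \<open>C (\<alpha> - u\<^sup>2) + D u\<^sup>2\<close> of the hypotheses, in which \<open>\<alpha>\<close> is either the root at which \<open>C\<close> and
  \<open>D\<close> are taken or the other one. After the division by cubes of the root in the main term,
  the two kinds differ by the sixth power of a root, that is, by a shift of three in the exponent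
  of \<open>r\<close>.\<close>

lemma band_main_entry:
  assumes i: "2 \<le> i" "i + 2 < n"
    and K1_y: "C w (u * y) * (u * y - u ^ 2) + D w (u * y) * u ^ 2 = \<tau> * y ^ 3 / u ^ 3 * A"
    and K2_y: "C w (u * y) * (u * z - u ^ 2) + D w (u * y) * u ^ 2 = \<tau> / (u ^ 3 * y ^ 3) * B"
    and K1_z: "C w (u * z) * (u * z - u ^ 2) + D w (u * z) * u ^ 2 = \<tau> * z ^ 3 / u ^ 3 * A'"
    and K2_z: "C w (u * z) * (u * y - u ^ 2) + D w (u * z) * u ^ 2 = \<tau> / (u ^ 3 * z ^ 3) * B'"
  shows "band_main C D w n (i + 1) =
    - (A - r ^ (n - i) * B - \<Theta> * (r ^ (i - 1) * B' - r ^ (n - 1) * A')) / (\<tau> * (y - z))"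
proof -
  obtain m where m: "n = i + 3 + m" using i(2) less_imp_Suc_add[of "i + 2" n] by auto
  obtain l where l: "i = 2 + l" using i(1) le_Suc_ex by blast
  have e: "n - (i + 1) - 2 = m" "n - (l + 3) - 2 = m" "i - 1 = l + 1" "n - i = m + 3" "i + 1 = l + 3" "n - 2 = m + l + 3" "n - 1 = m + l + 4"
    using i by (auto simp: m l)
  define N where "N = coef_at w * (u * y) + u ^ 2 * coef_bt w"
  have N: "N \<noteq> 0" "coef_at w * (u * z) + u ^ 2 * coef_bt w = r * \<Theta> * N"
    using boundary_ratio by (auto simp: N_def)
  have nz: "u \<noteq> 0" "\<tau> \<noteq> 0" "z \<noteq> 0" "y - z \<noteq> 0" using Z.tau_pos u_pos z_neg y_less_z by auto
  define p where "p = inverse ((- (\<tau> * y)) ^ 3)"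
  define q where "q = inverse ((- (\<tau> * z)) ^ 3)"
  define f where "f = \<tau> * u ^ 3 / (y - z)"
  have f: "x * \<tau> * u ^ 4 / (u * y - u * z) = f * x" "x * \<tau> * u ^ 6 / (u * y - u * z) = f * (x * u ^ 2)" for x
  proof -
    have "u * y - u * z = u * (y - z)" by (simp add: algebra_simps)
    then show "x * \<tau> * u ^ 4 / (u * y - u * z) = f * x" "x * \<tau> * u ^ 6 / (u * y - u * z) = f * (x * u ^ 2)"
      using nz by (simp_all add: f_def eval_nat_numeral)
  qed
  have g: "x * \<tau> * u ^ 4 * (r * \<Theta> * N) / ((u * y - u * z) * N) = f * (x * (r * \<Theta>))"
    "x * \<tau> * u ^ 6 * (r * \<Theta> * N) / ((u * y - u * z) * N) = f * (x * u ^ 2 * (r * \<Theta>))" for x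
  proof -
    have 1: "t * (r * \<Theta> * N) / (d * N) = t * (r * \<Theta>) / d" for t d using N(1) by simp
    have 2: "x * \<tau> * t * (r * \<Theta>) = (x * (r * \<Theta>)) * \<tau> * t" for t
      by (simp only: mult.assoc mult.commute mult.left_commute)
    then show "x * \<tau> * u ^ 4 * (r * \<Theta> * N) / ((u * y - u * z) * N) = f * (x * (r * \<Theta>))"
      "x * \<tau> * u ^ 6 * (r * \<Theta> * N) / ((u * y - u * z) * N) = f * (x * u ^ 2 * (r * \<Theta>))"
      unfolding 1 2 f by (simp_all only: mult.assoc mult.commute mult.left_commute)
  qed
  have "band_main C D w n (i + 1) =
     f * C w (u * y) * ((u * y - u ^ 2) / (- (\<tau> * y)) ^ 3 - (u * z - u ^ 2) / (- (\<tau> * y)) ^ 3 * r ^ m)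
     - f * (C w (u * z) * (r * \<Theta>)) * ((u * y - u ^ 2) / (- (\<tau> * z)) ^ 3 * r ^ (l + 3) - (u * z - u ^ 2) / (- (\<tau> * z)) ^ 3 * r ^ (m + l + 3))
     + f * (D w (u * y) * u ^ 2) * (1 / (- (\<tau> * y)) ^ 3 - 1 / (- (\<tau> * y)) ^ 3 * r ^ m)
     - f * (D w (u * z) * u ^ 2 * (r * \<Theta>)) * (1 / (- (\<tau> * z)) ^ 3 * r ^ (l + 3) - 1 / (- (\<tau> * z)) ^ 3 * r ^ (m + l + 3))"
    unfolding band_main_def Let_def u_def[symmetric] alpha1_eq alpha2_eq alpha_ratio e cube_roots
      N_def[symmetric] N(2) f g by (rule refl)
  also have "\<dots> = f * (p * ((C w (u * y) * (u * y - u ^ 2) + D w (u * y) * u ^ 2) - (C w (u * y) * (u * z - u ^ 2) + D w (u * y) * u ^ 2) * r ^ m)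
     - q * (r * \<Theta>) * ((C w (u * z) * (u * y - u ^ 2) + D w (u * z) * u ^ 2) * r ^ (l + 3)
         - (C w (u * z) * (u * z - u ^ 2) + D w (u * z) * u ^ 2) * r ^ (m + l + 3)))"
    unfolding divide_inverse p_def[symmetric] q_def[symmetric] by (simp only: algebra_simps)
  also have "\<dots> = f * ((p * (\<tau> * y ^ 3 / u ^ 3)) * A - (p * (\<tau> / (u ^ 3 * y ^ 3)) * r ^ m) * B
     - \<Theta> * ((q * r * (\<tau> / (u ^ 3 * z ^ 3)) * r ^ (l + 3)) * B' - (q * r * (\<tau> * z ^ 3 / u ^ 3) * r ^ (m + l + 3)) * A'))"
    unfolding K1_y K2_y K1_z K2_z by (simp only: algebra_simps)
  also have "p * (\<tau> * y ^ 3 / u ^ 3) = - 1 / (\<tau> ^ 2 * u ^ 3)"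
    unfolding p_def y_eq using nz by (simp add: field_simps eval_nat_numeral)
  also have "p * (\<tau> / (u ^ 3 * y ^ 3)) * r ^ m = - 1 / (\<tau> ^ 2 * u ^ 3) * r ^ (m + 3)"
    unfolding p_def y_eq using nz by (simp add: field_simps eval_nat_numeral)
  also have "q * r * (\<tau> / (u ^ 3 * z ^ 3)) * r ^ (l + 3) = - 1 / (\<tau> ^ 2 * u ^ 3) * r ^ (l + 1)"
    unfolding q_def using nz by (simp add: field_simps eval_nat_numeral)
  also have "q * r * (\<tau> * z ^ 3 / u ^ 3) * r ^ (m + l + 3) = - 1 / (\<tau> ^ 2 * u ^ 3) * r ^ (m + l + 4)"
    unfolding q_def using nz by (simp add: field_simps eval_nat_numeral)
  also have "f * (- 1 / (\<tau> ^ 2 * u ^ 3) * A - - 1 / (\<tau> ^ 2 * u ^ 3) * r ^ (m + 3) * B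
     - \<Theta> * (- 1 / (\<tau> ^ 2 * u ^ 3) * r ^ (l + 1) * B' - - 1 / (\<tau> ^ 2 * u ^ 3) * r ^ (m + l + 4) * A'))
     = f * (- 1 / (\<tau> ^ 2 * u ^ 3)) * (A - r ^ (m + 3) * B - \<Theta> * (r ^ (l + 1) * B' - r ^ (m + l + 4) * A'))"
    by (simp only: algebra_simps)
  also have "f * (- 1 / (\<tau> ^ 2 * u ^ 3)) = - 1 / (\<tau> * (y - z))"
    unfolding f_def using nz by (simp add: power2_eq_square)
  finally show ?thesis unfolding e by (simp only: divide_inverse mult_minus_left mult_1_left mult.commute)
qed

lemma inv_roots: "x / y = x * z" "x / z = x * y"
  using yz z_neg y_less_z by (auto simp: field_simps)

text \<open>With the coefficients from \<open>diag_K\<close>, the four powers of \<open>r\<close> recombine into a product of two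
  filtered solutions, and the correction terms into a multiple of \<open>1 - \<Theta> r\<^sup>n\<^sup>-\<^sup>1\<close>.\<close>

lemma main_diag_entry:
  assumes "2 \<le> i" "i + 2 < n"
  shows "main_diag w n (i + 1) =
    - ((P - \<Theta> * r ^ (i - 1) * Q) * (Q - r ^ (n - i) * P)) / (\<tau> * (y - z))
    + (u ^ 2 * (y + z) - 2 * u - 2 * u ^ 3) / \<tau> * (1 - \<Theta> * r ^ (n - 1))"
proof -
  define c where "c = u ^ 2 * (y + z) - 2 * u - 2 * u ^ 3"
  have nz: "\<tau> \<noteq> 0" "y - z \<noteq> 0" using Z.tau_pos y_less_z by auto
  have c': "u ^ 2 * (z + y) - 2 * u - 2 * u ^ 3 = c" by (simp add: c_def add.commute)
  have rr: "r ^ (n - 1) = r ^ (i - 1) * r ^ (n - i)" using assms by (simp flip: power_add)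
  have "band_main C1 C2 w n (i + 1) = - ((P * Q + (z - y) * c) - r ^ (n - i) * (1 - u * y) ^ 4
      - \<Theta> * (r ^ (i - 1) * (1 - u * z) ^ 4 - r ^ (n - 1) * (Q * P + (y - z) * c))) / (\<tau> * (y - z))"
    using Y.diag_K Z.diag_K unfolding inv_roots mult_1_left c_def[symmetric] c'
    by (intro band_main_entry assms) 
  also have "(1 - u * y) ^ 4 = P * P" by (simp flip: power_add)
  also have "(1 - u * z) ^ 4 = Q * Q" by (simp flip: power_add)
  also have "- ((P * Q + (z - y) * c) - r ^ (n - i) * (P * P)
      - \<Theta> * (r ^ (i - 1) * (Q * Q) - r ^ (n - 1) * (Q * P + (y - z) * c)))
      = - ((P - \<Theta> * r ^ (i - 1) * Q) * (Q - r ^ (n - i) * P)) + c * (1 - \<Theta> * r ^ (n - 1)) * (y - z)"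
    unfolding rr by (simp only: algebra_simps)
  finally show ?thesis unfolding main_diag_def c_def[symmetric]
    using nz by (simp add: add_divide_distrib diff_divide_distrib)
qed

lemma main_superdiag_entry:
  assumes "2 \<le> i" "i + 2 < n"
  shows "main_superdiag w n (i + 1) =
    - (z * (P - \<Theta> * r ^ (i - 1) * Q) * (Q - r ^ (n - i - 1) * P)) / (\<tau> * (y - z))
    + u ^ 2 / \<tau> * (1 - \<Theta> * r ^ (n - 1))"
proof -
  have nz: "\<tau> \<noteq> 0" "y - z \<noteq> 0" using Z.tau_pos y_less_z by auto
  define R where "R = r ^ (n - i - 1)"
  have "n - i = Suc (n - i - 1)" using assms by simp
  then have "r ^ (n - i) = r * R" by (metis R_def power_Suc)
  then have "r ^ (n - i) * y = z * R * (y * z)" by (simp add: power2_eq_square)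
  then have rz: "r ^ (n - i) * y = z * R" unfolding yz by simp
  have rr: "r ^ (n - 1) * y = r ^ (i - 1) * (z * R)"
  proof -
    have "r ^ (n - 1) = r ^ (i - 1) * r ^ (n - i)" using assms by (simp flip: power_add)
    then show ?thesis using rz by simp
  qed
  have "band_main C4 C5 w n (i + 1) = - ((- z * P * Q - u ^ 2 * (z - y)) - r ^ (n - i) * (- y * (1 - u * y) ^ 4)
      - \<Theta> * (r ^ (i - 1) * (- z * (1 - u * z) ^ 4) - r ^ (n - 1) * (- y * Q * P - u ^ 2 * (y - z)))) / (\<tau> * (y - z))"
    using Y.superdiag_K Z.superdiag_K unfolding inv_roots mult_1_left
    by (intro band_main_entry assms)
  also have "(1 - u * y) ^ 4 = P * P" by (simp flip: power_add)
  also have "(1 - u * z) ^ 4 = Q * Q" by (simp flip: power_add)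
  also have "- ((- z * P * Q - u ^ 2 * (z - y)) - r ^ (n - i) * (- y * (P * P))
      - \<Theta> * (r ^ (i - 1) * (- z * (Q * Q)) - r ^ (n - 1) * (- y * Q * P - u ^ 2 * (y - z))))
      = z * P * Q - u ^ 2 * (y - z) - (r ^ (n - i) * y) * (P * P)
        - \<Theta> * (r ^ (i - 1) * z * (Q * Q) - (r ^ (n - 1) * y) * Q * P - r ^ (n - 1) * u ^ 2 * (y - z))"
    by (simp add: algebra_simps)
  also have "\<dots> = z * (P - \<Theta> * r ^ (i - 1) * Q) * (Q - R * P) - u ^ 2 * (1 - \<Theta> * r ^ (n - 1)) * (y - z)"
    unfolding rz rr by (simp add: algebra_simps)
  finally show ?thesis unfolding main_superdiag_def R_def[symmetric]
    using nz by (simp add: add_divide_distrib diff_divide_distrib)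
qed

end

section \<open>Error bound and conclusion\<close>

text \<open>The four main terms differ from the entries only by the factor \<open>1 - x\<close> of the Wronskian, so one
  and the same \<open>x = \<Theta> r\<^sup>n\<^sup>-\<^sup>1\<close> serves all entries. The condition \<open>\<theta> \<le> n\<close> means
  \<open>w \<le> 1\<close>, which gives \<open>0 < \<Theta> \<le> 1\<close>.\<close>

lemma Rinv_main_exact:
  fixes \<theta> :: real and n :: nat
  assumes n: "4 \<le> n" and \<theta>: "0 < \<theta>" "\<theta> \<le> real n"
  obtains x where "0 \<le> x" "x \<le> ((2 - sqrt 3) / (2 + sqrt 3)) ^ (n - 1)"
    "invertible_mat (Rmat \<theta> n)"
    "\<And>i. 3 \<le> i \<Longrightarrow> i \<le> n - 2 \<Longrightarrow> Rinv \<theta> n i i * (1 - x) = main_diag (\<theta> / real n) n i"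
    "\<And>i j. 5 \<le> i + 2 \<Longrightarrow> i + 2 \<le> j \<Longrightarrow> j \<le> n - 1 \<Longrightarrow>
       Rinv \<theta> n i j * (1 - x) = main_offdiag (\<theta> / real n) n i j"
    "\<And>i. 3 \<le> i \<Longrightarrow> i \<le> n - 2 \<Longrightarrow> Rinv \<theta> n i (i + 1) * (1 - x) = main_superdiag (\<theta> / real n) n i"
    "\<And>i. 3 \<le> i \<Longrightarrow> i \<le> n - 2 \<Longrightarrow> Rinv \<theta> n i n * (1 - x) = main_lastcol (\<theta> / real n) n i"
proof -
  define w where "w = \<theta> / real n"
  have w: "0 < w" "w \<le> 1" using assms by (auto simp: w_def)
  obtain y z where yz: "spectrum w (exp (- w)) y z" and z: "z ^ 2 \<le> (2 - sqrt 3) / (2 + sqrt 3)"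
    using spectrum_exists[OF w] .
  interpret spectrum w "exp (- w)" y z by (rule yz)
  define x where "x = \<Theta> * r ^ (n - 1)"
  have "0 \<le> x" using Theta_bounds r_bounds by (simp add: x_def)
  moreover have "x \<le> ((2 - sqrt 3) / (2 + sqrt 3)) ^ (n - 1)"
  proof -
    have "x \<le> 1 * r ^ (n - 1)" unfolding x_def using Theta_bounds by (intro mult_right_mono) auto
    also have "\<dots> \<le> ((2 - sqrt 3) / (2 + sqrt 3)) ^ (n - 1)" using z by (simp add: power_mono)
    finally show ?thesis .
  qed
  moreover have "invertible_mat (Rmat \<theta> n)" using n by (intro Rinv_entries(1)) (auto simp: w_def)
  moreover have "Rinv \<theta> n i i * (1 - x) = main_diag (\<theta> / real n) n i" if "3 \<le> i" "i \<le> n - 2" for i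
  proof -
    have i: "2 \<le> i - 1" "i - 1 + 2 < n" "i - 1 + 1 = i" using that n by auto
    show ?thesis using entry_diag[OF n _ i(1,2)] main_diag_entry[OF i(1,2)] unfolding i(3)
      by (simp add: x_def w_def)
  qed
  moreover have "Rinv \<theta> n i j * (1 - x) = main_offdiag (\<theta> / real n) n i j"
    if "5 \<le> i + 2" "i + 2 \<le> j" "j \<le> n - 1" for i j
  proof -
    have i: "2 \<le> i - 1" "i - 1 + 2 \<le> j - 1" "j - 1 + 2 \<le> n" "i - 1 + 1 = i" "j - 1 + 1 = j" using that n by auto
    show ?thesis using entry_far[OF n _ i(1-3)] main_offdiag_entry[OF i(1-3)] unfolding i(4,5)
      by (simp add: x_def w_def)
  qed
  moreover have "Rinv \<theta> n i (i + 1) * (1 - x) = main_superdiag (\<theta> / real n) n i" if "3 \<le> i" "i \<le> n - 2" for i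
  proof -
    have i: "2 \<le> i - 1" "i - 1 + 2 < n" "i - 1 + 1 = i" "i - 1 + 2 = i + 1" using that n by auto
    show ?thesis using entry_superdiag[OF n _ i(1,2)] main_superdiag_entry[OF i(1,2)] unfolding i(3,4)
      by (simp add: x_def w_def)
  qed
  moreover have "Rinv \<theta> n i n * (1 - x) = main_lastcol (\<theta> / real n) n i" if "3 \<le> i" "i \<le> n - 2" for i
  proof -
    have i: "2 \<le> i - 1" "i - 1 + 2 < n" "i - 1 + 1 = i" using that n by auto
    show ?thesis using entry_last[OF n _ i(1,2)] main_lastcol_entry[OF i(1,2)] unfolding i(3)
      by (simp add: x_def w_def)
  qed
  ultimately show ?thesis by (rule that)
qed

text \<open>As \<open>x \<le> 1/2\<close>, passing from \<open>1 / (1 - x)\<close> to \<open>1 + \<epsilon>\<close> costs a factor of 2; the other factor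
  \<open>1 / \<rho>\<close> compensates for the exponent \<open>n - 1\<close>.\<close>

lemma relative_error:
  fixes \<rho> x e m :: real
  assumes \<rho>: "0 < \<rho>" "\<rho> \<le> 1 / 2" and n: "2 \<le> n" and x: "0 \<le> x" "x \<le> \<rho> ^ (n - 1)" and e: "e * (1 - x) = m"
  shows "\<exists>\<epsilon>. \<bar>\<epsilon>\<bar> \<le> 2 / \<rho> * \<rho> ^ n \<and> e = m * (1 + \<epsilon>)"
proof (intro exI conjI)
  have "\<rho> ^ (n - 1) \<le> \<rho> ^ 1" using \<rho> n by (intro power_decreasing) auto
  then have half: "x \<le> 1 / 2" using x \<rho> by simp
  have "x / (1 - x) \<le> x / (1 / 2)" using half x by (intro divide_left_mono) auto
  also have "\<dots> \<le> 2 * \<rho> ^ (n - 1)" using x by simp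
  also have "\<dots> = 2 / \<rho> * \<rho> ^ n" using \<rho> n by (simp add: power_eq_if)
  finally show "\<bar>x / (1 - x)\<bar> \<le> 2 / \<rho> * \<rho> ^ n" using x half by simp
  show "e = m * (1 + x / (1 - x))" using half unfolding e[symmetric] by (simp add: field_simps)
qed

theorem theorem7:
  fixes \<beta>\<^sub>0 \<beta>\<^sub>1 \<rho> :: real
  assumes "0 < \<beta>\<^sub>0" and "\<beta>\<^sub>0 < \<beta>\<^sub>1"
    and "\<rho> = (2 - sqrt 3) / (2 + sqrt 3)"
  shows
   "(\<forall>\<^sub>F n in sequentially. \<forall>\<theta>\<in>{\<beta>\<^sub>0..\<beta>\<^sub>1}. invertible_mat (Rmat \<theta> n)) \<and>
    (\<exists>K. \<forall>\<^sub>F n in sequentially. \<forall>\<theta>\<in>{\<beta>\<^sub>0..\<beta>\<^sub>1}. \<forall>i. 3 \<le> i \<and> i \<le> n - 2 \<longrightarrow>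
       (\<exists>\<epsilon>. \<bar>\<epsilon>\<bar> \<le> K * \<rho> ^ n \<and>
            Rinv \<theta> n i i = main_diag (\<theta> / real n) n i * (1 + \<epsilon>))) \<and>
    (\<exists>K. \<forall>\<^sub>F n in sequentially. \<forall>\<theta>\<in>{\<beta>\<^sub>0..\<beta>\<^sub>1}. \<forall>i j. 5 \<le> i + 2 \<and> i + 2 \<le> j \<and> j \<le> n - 1 \<longrightarrow>
       (\<exists>\<epsilon>. \<bar>\<epsilon>\<bar> \<le> K * \<rho> ^ n \<and>
            Rinv \<theta> n i j = main_offdiag (\<theta> / real n) n i j * (1 + \<epsilon>))) \<and>
    (\<exists>K. \<forall>\<^sub>F n in sequentially. \<forall>\<theta>\<in>{\<beta>\<^sub>0..\<beta>\<^sub>1}. \<forall>i. 3 \<le> i \<and> i \<le> n - 2 \<longrightarrow>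
       (\<exists>\<epsilon>. \<bar>\<epsilon>\<bar> \<le> K * \<rho> ^ n \<and>
            Rinv \<theta> n i (i + 1) = main_superdiag (\<theta> / real n) n i * (1 + \<epsilon>))) \<and>
    (\<exists>K. \<forall>\<^sub>F n in sequentially. \<forall>\<theta>\<in>{\<beta>\<^sub>0..\<beta>\<^sub>1}. \<forall>i. 3 \<le> i \<and> i \<le> n - 2 \<longrightarrow>
       (\<exists>\<epsilon>. \<bar>\<epsilon>\<bar> \<le> K * \<rho> ^ n \<and>
            Rinv \<theta> n i n = main_lastcol (\<theta> / real n) n i * (1 + \<epsilon>)))"
proof -
  have sqrt3: "3 / 2 \<le> sqrt (3 :: real)"
    by (rule real_le_rsqrt) (simp add: power2_eq_square)
  have sqrt3': "sqrt 3 < (2 :: real)"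
    by (rule real_less_lsqrt) auto
  have \<rho>: "0 < \<rho>" "\<rho> \<le> 1 / 2" unfolding assms(3) using sqrt3 sqrt3' by (auto simp: field_simps)
  have large: "\<forall>\<^sub>F n in sequentially. 4 \<le> n \<and> \<beta>\<^sub>1 \<le> real n"
    using eventually_ge_at_top[of 4] eventually_ge_at_top[of "nat \<lceil>\<beta>\<^sub>1\<rceil>"]
    by eventually_elim (auto simp: nat_ceiling_le_eq)
  let ?close = "\<lambda>n e m. \<exists>\<epsilon>. \<bar>\<epsilon>\<bar> \<le> 2 / \<rho> * \<rho> ^ n \<and> e = m * (1 + \<epsilon>)"
  have main: "invertible_mat (Rmat \<theta> n)
      \<and> (\<forall>i. 3 \<le> i \<and> i \<le> n - 2 \<longrightarrow> ?close n (Rinv \<theta> n i i) (main_diag (\<theta> / real n) n i))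
      \<and> (\<forall>i j. 5 \<le> i + 2 \<and> i + 2 \<le> j \<and> j \<le> n - 1 \<longrightarrow>
            ?close n (Rinv \<theta> n i j) (main_offdiag (\<theta> / real n) n i j))
      \<and> (\<forall>i. 3 \<le> i \<and> i \<le> n - 2 \<longrightarrow> ?close n (Rinv \<theta> n i (i + 1)) (main_superdiag (\<theta> / real n) n i))
      \<and> (\<forall>i. 3 \<le> i \<and> i \<le> n - 2 \<longrightarrow> ?close n (Rinv \<theta> n i n) (main_lastcol (\<theta> / real n) n i))"
    if n: "4 \<le> n \<and> \<beta>\<^sub>1 \<le> real n" and \<theta>: "\<theta> \<in> {\<beta>\<^sub>0..\<beta>\<^sub>1}" for n \<theta>
  proof -
    have "4 \<le> n" "0 < \<theta>" "\<theta> \<le> real n" using n \<theta> assms(1) by auto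
    then obtain x where x: "0 \<le> x" "x \<le> ((2 - sqrt 3) / (2 + sqrt 3)) ^ (n - 1)"
      "invertible_mat (Rmat \<theta> n)"
      "\<And>i. 3 \<le> i \<Longrightarrow> i \<le> n - 2 \<Longrightarrow> Rinv \<theta> n i i * (1 - x) = main_diag (\<theta> / real n) n i"
      "\<And>i j. 5 \<le> i + 2 \<Longrightarrow> i + 2 \<le> j \<Longrightarrow> j \<le> n - 1 \<Longrightarrow>
         Rinv \<theta> n i j * (1 - x) = main_offdiag (\<theta> / real n) n i j"
      "\<And>i. 3 \<le> i \<Longrightarrow> i \<le> n - 2 \<Longrightarrow> Rinv \<theta> n i (i + 1) * (1 - x) = main_superdiag (\<theta> / real n) n i"
      "\<And>i. 3 \<le> i \<Longrightarrow> i \<le> n - 2 \<Longrightarrow> Rinv \<theta> n i n * (1 - x) = main_lastcol (\<theta> / real n) n i"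
      using Rinv_main_exact[of n \<theta>] by blast
    have close: "?close n e m" if "e * (1 - x) = m" for e m
      by (rule relative_error[OF \<rho> _ x(1) _ that]) (use n x(2) assms(3) in auto)
    show ?thesis by (intro conjI allI impI x(3) close x(4-7)) auto
  qed
  have ev: "\<forall>\<^sub>F n in sequentially. \<forall>\<theta>\<in>{\<beta>\<^sub>0..\<beta>\<^sub>1}. S \<theta> n"
    if "\<And>n \<theta>. 4 \<le> n \<and> \<beta>\<^sub>1 \<le> real n \<Longrightarrow> \<theta> \<in> {\<beta>\<^sub>0..\<beta>\<^sub>1} \<Longrightarrow> S \<theta> n" for S
    using large by (rule eventually_mono) (use that in blast)
  show ?thesis
    by (intro conjI exI[of _ "2 / \<rho>"] ev) (use main in blast)+
qed

end
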